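(* Let $G$ be a compact Lie group, let $R$ be a commutative ring, let $f,g\colon X\to Y$ be $G$-maps between $G$-spaces, and let $\Delta\colon Y\to Y\times Y$ be the diagonal map (with diagonal $G$-action on $Y\times Y$). Then: (1) Suppose there exist classes $z_1,\dots,z_k\in H_G^*(Y\times Y;R)$ such that $(\Delta^h_G)^*(z_i)=0$ for all $1\le i\le k$ and $((f,g)^h_G)^*(z_1\smile\dots\smile z_k)\neq 0$ in $H^*_G(X;R)$. Then $D_G(f,g)\ge k$. (2) Let $$\mathcal{J}_{f,g}:=\mathrm{Im}\big((f^h_G)^*-(g^h_G)^*\colon H_G^*(Y;R)\to H_G^*(X;R)\big)\subseteq H_G^*(X;R).$$ Then $D_G(f,g)\ge \mathrm{nil}(\mathcal{J}_{f,g})$.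
   Context: Borel cohomology: $EG\to BG$ is the universal principal $G$-bundle, $X^h_G:=EG\times_G X$ is the homotopy orbit space of a $G$-space $X$, and $H^*_G(X;R):=H^*(X^h_G;R)$. A $G$-map $f\colon X\to Y$ induces $f^h_G\colon X^h_G\to Y^h_G$. Here $(f,g)\colon X\to Y\times Y$ is the $G$-map $x\mapsto (f(x),g(x))$. Nilpotency: $\mathrm{nil}(\mathcal J)$ is the largest integer $k\ge0$ for which there exist $k$ elements of $\mathcal J$ with nonzero cup product ($\infty$ if there is no largest). Equivariant homotopic distance: $D_G(f,g)$ is the least integer $n\ge 0$ such that $X$ has an open cover $\{U_0,\dots,U_n\}$ by $G$-invariant open sets with $f|_{U_i}\simeq_G g|_{U_i}$ ($G$-homotopic) for all $0\le i\le n$; it is $\infty$ if no such $n$ exists. *)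

theory Defs
  imports
    "HOL-Analysis.Analysis"
    "HOL-Algebra.Group_Action"
    "HOL-Algebra.QuotRing"
    "HOL-Homology.Homology"
begin

section \<open>Compact Lie groups\<close>

text \<open>
  \<open>R\<^sup>n\<close> is the library space \<open>Euclidean_space n\<close> of functions \<open>nat \<Rightarrow> real\<close> vanishing from \<open>n\<close> on,
  so that the dimension \<open>n = 0\<close> (finite groups) is included.  \<open>Ck_on n k U f\<close> says that all
  iterated partial derivatives of \<open>f\<close> of order at most \<open>k\<close> exist and are continuous on \<open>U\<close>.  It is
  only used for open \<open>U\<close>, so that the partial derivatives depend only on the values of \<open>f\<close> on \<open>U\<close>.
\<close>

primrec Ck_on :: "nat \<Rightarrow> nat \<Rightarrow> (nat \<Rightarrow> real) set \<Rightarrow> ((nat \<Rightarrow> real) \<Rightarrow> real) \<Rightarrow> bool" where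
  "Ck_on n 0 U f \<longleftrightarrow> continuous_map (subtopology (Euclidean_space n) U) euclideanreal f"
| "Ck_on n (Suc k) U f \<longleftrightarrow>
     continuous_map (subtopology (Euclidean_space n) U) euclideanreal f \<and>
     (\<forall>i<n. (\<forall>x\<in>U. (\<lambda>t. f (x(i := t))) field_differentiable (at (x i))) \<and>
            Ck_on n k U (\<lambda>x. deriv (\<lambda>t. f (x(i := t))) (x i)))"

definition smooth_map_on ::
    "nat \<Rightarrow> (nat \<Rightarrow> real) set \<Rightarrow> nat \<Rightarrow> ((nat \<Rightarrow> real) \<Rightarrow> (nat \<Rightarrow> real)) \<Rightarrow> bool" where
  "smooth_map_on n U m F \<longleftrightarrow> (\<forall>k. \<forall>j<m. Ck_on n k U (\<lambda>x. F x j))"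

definition chart :: "'g topology \<Rightarrow> nat \<Rightarrow> 'g set \<Rightarrow> ('g \<Rightarrow> nat \<Rightarrow> real) \<Rightarrow> bool" where
  "chart T n U \<phi> \<longleftrightarrow> openin T U \<and> openin (Euclidean_space n) (\<phi> ` U) \<and>
     homeomorphic_map (subtopology T U) (subtopology (Euclidean_space n) (\<phi> ` U)) \<phi>"

definition smooth_atlas :: "'g topology \<Rightarrow> nat \<Rightarrow> ('g set \<times> ('g \<Rightarrow> nat \<Rightarrow> real)) set \<Rightarrow> bool" where
  "smooth_atlas T n A \<longleftrightarrow>
     (\<forall>(U, \<phi>)\<in>A. chart T n U \<phi>) \<and> (\<Union>(U, \<phi>)\<in>A. U) = topspace T \<and>
     (\<forall>(U, \<phi>)\<in>A. \<forall>(V, \<psi>)\<in>A. smooth_map_on n (\<phi> ` (U \<inter> V)) n (\<psi> \<circ> inv_into U \<phi>))"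

definition topological_group :: "('g, 'm) monoid_scheme \<Rightarrow> 'g topology \<Rightarrow> bool" where
  "topological_group G T \<longleftrightarrow> group G \<and> topspace T = carrier G \<and>
     continuous_map (prod_topology T T) T (\<lambda>(x, y). x \<otimes>\<^bsub>G\<^esub> y) \<and>
     continuous_map T T (\<lambda>x. inv\<^bsub>G\<^esub> x)"

text \<open>The two halves of a vector in \<open>R\<^sup>2\<^sup>n\<close>, identifying \<open>R\<^sup>2\<^sup>n\<close> with \<open>R\<^sup>n \<times> R\<^sup>n\<close>.\<close>

definition fst_half :: "nat \<Rightarrow> (nat \<Rightarrow> real) \<Rightarrow> nat \<Rightarrow> real" where
  "fst_half n z = (\<lambda>i. if i < n then z i else 0)"

definition snd_half :: "nat \<Rightarrow> (nat \<Rightarrow> real) \<Rightarrow> nat \<Rightarrow> real" where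
  "snd_half n z = (\<lambda>i. if i < n then z (n + i) else 0)"

text \<open>
  Smoothness of multiplication and inversion is tested in charts.  Second countability is not
  listed since it follows from compactness of a locally Euclidean space.
\<close>

definition compact_lie_group :: "('g, 'm) monoid_scheme \<Rightarrow> 'g topology \<Rightarrow> bool" where
  "compact_lie_group G T \<longleftrightarrow>
     topological_group G T \<and> compact_space T \<and> Hausdorff_space T \<and>
     (\<exists>n A. smooth_atlas T n A \<and>
        (\<forall>(U, \<phi>)\<in>A. \<forall>(V, \<psi>)\<in>A. \<forall>(W, \<xi>)\<in>A.
           let m = (\<lambda>z. inv_into U \<phi> (fst_half n z) \<otimes>\<^bsub>G\<^esub> inv_into V \<psi> (snd_half n z))
           in smooth_map_on (n + n)
                {z \<in> topspace (Euclidean_space (n + n)).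
                   fst_half n z \<in> \<phi> ` U \<and> snd_half n z \<in> \<psi> ` V \<and> m z \<in> W}
                n (\<xi> \<circ> m)) \<and>
        (\<forall>(U, \<phi>)\<in>A. \<forall>(V, \<psi>)\<in>A.
           smooth_map_on n (\<phi> ` {x \<in> U. inv\<^bsub>G\<^esub> x \<in> V}) n
             (\<lambda>y. \<psi> (inv\<^bsub>G\<^esub> (inv_into U \<phi> y)))))"


section \<open>G-spaces\<close>

text \<open>
  All actions are left actions, in the sense of the library locale \<open>group_action\<close>; in particular
  \<open>\<alpha> g\<close> is extensional, i.e. \<open>undefined\<close> outside \<open>topspace X\<close>.
\<close>

definition G_space ::
    "('g, 'm) monoid_scheme \<Rightarrow> 'g topology \<Rightarrow> 'x topology \<Rightarrow> ('g \<Rightarrow> 'x \<Rightarrow> 'x) \<Rightarrow> bool" where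
  "G_space G T X \<alpha> \<longleftrightarrow> group_action G (topspace X) \<alpha> \<and>
     continuous_map (prod_topology T X) X (\<lambda>(g, x). \<alpha> g x)"

definition G_map ::
    "('g, 'm) monoid_scheme \<Rightarrow> 'x topology \<Rightarrow> ('g \<Rightarrow> 'x \<Rightarrow> 'x) \<Rightarrow>
     'y topology \<Rightarrow> ('g \<Rightarrow> 'y \<Rightarrow> 'y) \<Rightarrow> ('x \<Rightarrow> 'y) \<Rightarrow> bool" where
  "G_map G X \<alpha> Y \<beta> f \<longleftrightarrow> continuous_map X Y f \<and>
     (\<forall>g\<in>carrier G. \<forall>x\<in>topspace X. f (\<alpha> g x) = \<beta> g (f x))"

definition diag_action ::
    "'x topology \<Rightarrow> ('g \<Rightarrow> 'x \<Rightarrow> 'x) \<Rightarrow> 'y topology \<Rightarrow> ('g \<Rightarrow> 'y \<Rightarrow> 'y) \<Rightarrow> 'g \<Rightarrow> 'x \<times> 'y \<Rightarrow> 'x \<times> 'y" where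
  "diag_action X \<alpha> Y \<beta> g =
     restrict (\<lambda>(x, y). (\<alpha> g x, \<beta> g y)) (topspace X \<times> topspace Y)"

definition orbit_space ::
    "('g, 'm) monoid_scheme \<Rightarrow> 'x topology \<Rightarrow> ('g \<Rightarrow> 'x \<Rightarrow> 'x) \<Rightarrow> 'x set topology" where
  "orbit_space G X \<alpha> = topology (\<lambda>V. V \<subseteq> orbits G (topspace X) \<alpha> \<and>
     openin X {x \<in> topspace X. orbit G \<alpha> x \<in> V})"

lemma openin_orbit_space:
  "openin (orbit_space G X \<alpha>) V \<longleftrightarrow>
     V \<subseteq> orbits G (topspace X) \<alpha> \<and> openin X {x \<in> topspace X. orbit G \<alpha> x \<in> V}"
proof -
  let ?P = "\<lambda>V. V \<subseteq> orbits G (topspace X) \<alpha> \<and> openin X {x \<in> topspace X. orbit G \<alpha> x \<in> V}"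
  have "?P (S \<inter> S')" if "?P S" "?P S'" for S S'
  proof -
    have "{x \<in> topspace X. orbit G \<alpha> x \<in> S \<inter> S'} =
        {x \<in> topspace X. orbit G \<alpha> x \<in> S} \<inter> {x \<in> topspace X. orbit G \<alpha> x \<in> S'}" by auto
    with that show ?thesis by auto
  qed
  moreover have "?P (\<Union>\<K>)" if "\<forall>K\<in>\<K>. ?P K" for \<K>
  proof -
    have "{x \<in> topspace X. orbit G \<alpha> x \<in> \<Union>\<K>} =
        (\<Union>K\<in>\<K>. {x \<in> topspace X. orbit G \<alpha> x \<in> K})" by auto
    with that show ?thesis by auto
  qed
  ultimately have "istopology ?P"
    unfolding istopology_def by blast
  then show ?thesis
    by (simp add: orbit_space_def topology_inverse')
qed

lemma quotient_map_orbit_space: "quotient_map X (orbit_space G X \<alpha>) (orbit G \<alpha>)"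
proof -
  let ?O = "orbits G (topspace X) \<alpha>"
  have "{x \<in> topspace X. orbit G \<alpha> x \<in> ?O} = topspace X"
    by (auto simp: orbits_def)
  then have "openin (orbit_space G X \<alpha>) ?O"
    by (simp add: openin_orbit_space)
  then have "topspace (orbit_space G X \<alpha>) = ?O"
    by (meson openin_orbit_space openin_subset openin_topspace subset_antisym)
  moreover have "orbit G \<alpha> ` topspace X = ?O"
    by (auto simp: orbits_def)
  ultimately show ?thesis
    by (simp add: quotient_map_def openin_orbit_space)
qed


section \<open>Universal principal bundles and homotopy orbit spaces\<close>

text \<open>
  A principal \<open>G\<close>-bundle is given by its total space \<open>E\<close>, the base being the orbit space.  A right
  action of \<open>G\<close> on \<open>E\<close> corresponds to the left action \<open>\<epsilon> g e = e \<cdot> g\<^sup>-\<^sup>1\<close> used here.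
\<close>

definition principal_bundle ::
    "('g, 'm) monoid_scheme \<Rightarrow> 'g topology \<Rightarrow> 'e topology \<Rightarrow> ('g \<Rightarrow> 'e \<Rightarrow> 'e) \<Rightarrow> bool" where
  "principal_bundle G T E \<epsilon> \<longleftrightarrow> G_space G T E \<epsilon> \<and>
     (\<forall>b\<in>topspace (orbit_space G E \<epsilon>). \<exists>V h. openin (orbit_space G E \<epsilon>) V \<and> b \<in> V \<and>
        homeomorphic_map (prod_topology T (subtopology (orbit_space G E \<epsilon>) V))
          (subtopology E {e \<in> topspace E. orbit G \<epsilon> e \<in> V}) h \<and>
        (\<forall>g\<in>carrier G. \<forall>v\<in>V. orbit G \<epsilon> (h (g, v)) = v) \<and>
        (\<forall>g\<in>carrier G. \<forall>g'\<in>carrier G. \<forall>v\<in>V. h (g \<otimes>\<^bsub>G\<^esub> g', v) = \<epsilon> g (h (g', v))))"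

text \<open>
  \<open>EG \<rightarrow> BG\<close> is determined only up to equivariant homotopy equivalence; any principal \<open>G\<close>-bundle
  with contractible total space is admitted as a model.  Nonemptiness has to be required because
  the empty space satisfies \<open>contractible_space\<close>.
\<close>

definition universal_principal_bundle ::
    "('g, 'm) monoid_scheme \<Rightarrow> 'g topology \<Rightarrow> 'e topology \<Rightarrow> ('g \<Rightarrow> 'e \<Rightarrow> 'e) \<Rightarrow> bool" where
  "universal_principal_bundle G T E \<epsilon> \<longleftrightarrow>
     principal_bundle G T E \<epsilon> \<and> topspace E \<noteq> {} \<and> contractible_space E"

text \<open>
  With \<open>\<epsilon> g e = e \<cdot> g\<^sup>-\<^sup>1\<close>, the classes of the relation \<open>(e \<cdot> g, x) \<sim> (e, g \<cdot> x)\<close> defining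
  \<open>EG \<times>\<^sub>G X\<close> are exactly the orbits of the diagonal action on \<open>EG \<times> X\<close>.
\<close>

definition homotopy_orbit_space ::
    "('g, 'm) monoid_scheme \<Rightarrow> 'e topology \<Rightarrow> ('g \<Rightarrow> 'e \<Rightarrow> 'e) \<Rightarrow>
     'x topology \<Rightarrow> ('g \<Rightarrow> 'x \<Rightarrow> 'x) \<Rightarrow> ('e \<times> 'x) set topology" where
  "homotopy_orbit_space G E \<epsilon> X \<alpha> = orbit_space G (prod_topology E X) (diag_action E \<epsilon> X \<alpha>)"

text \<open>
  For a \<open>G\<close>-map \<open>f\<close>, the induced map sends the orbit of \<open>(e, x)\<close> to the orbit of \<open>(e, f x)\<close>, which
  is the image of the former orbit under \<open>id \<times> f\<close>.
\<close>

definition homotopy_orbit_map :: "('x \<Rightarrow> 'y) \<Rightarrow> ('e \<times> 'x) set \<Rightarrow> ('e \<times> 'y) set" where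
  "homotopy_orbit_map f C = map_prod id f ` C"


section \<open>Singular cohomology rings\<close>

text \<open>
  Coefficients are taken in a type of sort \<open>{comm_ring, comm_monoid_mult}\<close>, i.e. a commutative ring
  with \<open>1\<close>; unlike the class \<open>comm_ring_1\<close> this does not exclude the zero ring.

  A cochain is an element of the direct sum over \<open>n\<close> of the modules of all functions from singular
  \<open>n\<close>-simplices of \<open>X\<close> to \<open>R\<close>; the functions are extended by \<open>0\<close> to non-simplices.
\<close>

type_synonym ('a, 'r) cochain = "nat \<Rightarrow> ((nat \<Rightarrow> real) \<Rightarrow> 'a) \<Rightarrow> 'r"

definition cochains ::
    "'r::{comm_ring, comm_monoid_mult} itself \<Rightarrow> 'a topology \<Rightarrow> ('a, 'r) cochain set" where
  "cochains R X = {c. (\<forall>n \<sigma>. \<not> singular_simplex n X \<sigma> \<longrightarrow> c n \<sigma> = 0) \<and>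
                      finite {n. c n \<noteq> (\<lambda>\<sigma>. 0)}}"

definition coboundary ::
    "'a topology \<Rightarrow> ('a, 'r::{comm_ring, comm_monoid_mult}) cochain \<Rightarrow> ('a, 'r) cochain" where
  "coboundary X c = (\<lambda>n \<sigma>. if n \<noteq> 0 \<and> singular_simplex n X \<sigma>
     then \<Sum>k\<le>n. (-1) ^ k * c (n - 1) (singular_face n k \<sigma>) else 0)"

text \<open>The front \<open>p\<close>-face and the back \<open>(n - p)\<close>-face of a singular \<open>n\<close>-simplex.\<close>

definition front_face :: "nat \<Rightarrow> ((nat \<Rightarrow> real) \<Rightarrow> 'a) \<Rightarrow> (nat \<Rightarrow> real) \<Rightarrow> 'a" where
  "front_face p \<sigma> = restrict \<sigma> (standard_simplex p)"

definition back_face :: "nat \<Rightarrow> nat \<Rightarrow> ((nat \<Rightarrow> real) \<Rightarrow> 'a) \<Rightarrow> (nat \<Rightarrow> real) \<Rightarrow> 'a" where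
  "back_face n p \<sigma> =
     restrict (\<lambda>x. \<sigma> (\<lambda>i. if i < p then 0 else x (i - p))) (standard_simplex (n - p))"

definition cup ::
    "'a topology \<Rightarrow> ('a, 'r::{comm_ring, comm_monoid_mult}) cochain \<Rightarrow> ('a, 'r) cochain \<Rightarrow>
     ('a, 'r) cochain" where
  "cup X a b = (\<lambda>n \<sigma>. if singular_simplex n X \<sigma>
     then \<Sum>p\<le>n. a p (front_face p \<sigma>) * b (n - p) (back_face n p \<sigma>) else 0)"

definition cocycle_ring ::
    "'r::{comm_ring, comm_monoid_mult} itself \<Rightarrow> 'a topology \<Rightarrow> ('a, 'r) cochain ring" where
  "cocycle_ring R X =
     \<lparr>carrier = {c \<in> cochains R X. coboundary X c = (\<lambda>n \<sigma>. 0)},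
      monoid.mult = cup X,
      monoid.one = (\<lambda>n \<sigma>. if n = 0 \<and> singular_simplex 0 X \<sigma> then 1 else 0),
      ring.zero = (\<lambda>n \<sigma>. 0),
      ring.add = (\<lambda>a b n \<sigma>. a n \<sigma> + b n \<sigma>)\<rparr>"

definition coboundaries ::
    "'r::{comm_ring, comm_monoid_mult} itself \<Rightarrow> 'a topology \<Rightarrow> ('a, 'r) cochain set" where
  "coboundaries R X = coboundary X ` cochains R X"

text \<open>The total cohomology ring \<open>H\<^sup>*(X; R)\<close>, whose multiplication is the cup product.\<close>

definition cohomology_ring ::
    "'r::{comm_ring, comm_monoid_mult} itself \<Rightarrow> 'a topology \<Rightarrow> ('a, 'r) cochain set ring" where
  "cohomology_ring R X = cocycle_ring R X Quot coboundaries R X"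

definition cochain_pullback ::
    "'a topology \<Rightarrow> ('a \<Rightarrow> 'b) \<Rightarrow> ('b, 'r::{comm_ring, comm_monoid_mult}) cochain \<Rightarrow>
     ('a, 'r) cochain" where
  "cochain_pullback X f c =
     (\<lambda>n \<sigma>. if singular_simplex n X \<sigma> then c n (simplex_map n f \<sigma>) else 0)"

text \<open>
  The map induced by a continuous map \<open>f\<close> from \<open>X\<close> to \<open>Y\<close> sends the class of a cocycle \<open>c\<close> of \<open>Y\<close>
  to the class of its pullback; all representatives \<open>c\<close> of \<open>z\<close> yield the same coset.
\<close>

definition cohomology_map ::
    "'r::{comm_ring, comm_monoid_mult} itself \<Rightarrow> 'a topology \<Rightarrow> ('a \<Rightarrow> 'b) \<Rightarrow>
     ('b, 'r) cochain set \<Rightarrow> ('a, 'r) cochain set" where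
  "cohomology_map R X f z =
     (\<Union>c\<in>z. coboundaries R X +>\<^bsub>cocycle_ring R X\<^esub> cochain_pullback X f c)"

definition ring_product :: "('a, 'm) ring_scheme \<Rightarrow> 'a list \<Rightarrow> 'a" where
  "ring_product H zs = foldr (\<lambda>x y. x \<otimes>\<^bsub>H\<^esub> y) zs \<one>\<^bsub>H\<^esub>"

text \<open>
  The supremum in \<open>enat\<close> is the maximum if there is one and \<open>\<infinity>\<close> if the products may be arbitrarily
  long.  In the zero ring even the empty product vanishes, and the supremum of the empty set is \<open>0\<close>.
\<close>

definition nil :: "('a, 'm) ring_scheme \<Rightarrow> 'a set \<Rightarrow> enat" where
  "nil H J = Sup {enat (length zs) | zs. set zs \<subseteq> J \<and> ring_product H zs \<noteq> \<zero>\<^bsub>H\<^esub>}"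


section \<open>Borel cohomology\<close>

definition borel_cohomology ::
    "'r::{comm_ring, comm_monoid_mult} itself \<Rightarrow> ('g, 'm) monoid_scheme \<Rightarrow>
     'e topology \<Rightarrow> ('g \<Rightarrow> 'e \<Rightarrow> 'e) \<Rightarrow> 'x topology \<Rightarrow> ('g \<Rightarrow> 'x \<Rightarrow> 'x) \<Rightarrow>
     (('e \<times> 'x) set, 'r) cochain set ring" where
  "borel_cohomology R G E \<epsilon> X \<alpha> = cohomology_ring R (homotopy_orbit_space G E \<epsilon> X \<alpha>)"

text \<open>\<open>(X, \<alpha>)\<close> is the domain of \<open>f\<close>.\<close>

definition borel_map ::
    "'r::{comm_ring, comm_monoid_mult} itself \<Rightarrow> ('g, 'm) monoid_scheme \<Rightarrow>
     'e topology \<Rightarrow> ('g \<Rightarrow> 'e \<Rightarrow> 'e) \<Rightarrow> 'x topology \<Rightarrow> ('g \<Rightarrow> 'x \<Rightarrow> 'x) \<Rightarrow> ('x \<Rightarrow> 'y) \<Rightarrow>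
     (('e \<times> 'y) set, 'r) cochain set \<Rightarrow> (('e \<times> 'x) set, 'r) cochain set" where
  "borel_map R G E \<epsilon> X \<alpha> f =
     cohomology_map R (homotopy_orbit_space G E \<epsilon> X \<alpha>) (homotopy_orbit_map f)"

definition borel_difference_image ::
    "'r::{comm_ring, comm_monoid_mult} itself \<Rightarrow> ('g, 'm) monoid_scheme \<Rightarrow>
     'e topology \<Rightarrow> ('g \<Rightarrow> 'e \<Rightarrow> 'e) \<Rightarrow> 'x topology \<Rightarrow> ('g \<Rightarrow> 'x \<Rightarrow> 'x) \<Rightarrow>
     'y topology \<Rightarrow> ('g \<Rightarrow> 'y \<Rightarrow> 'y) \<Rightarrow> ('x \<Rightarrow> 'y) \<Rightarrow> ('x \<Rightarrow> 'y) \<Rightarrow>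
     (('e \<times> 'x) set, 'r) cochain set set" where
  "borel_difference_image R G E \<epsilon> X \<alpha> Y \<beta> f g =
     (\<lambda>z. borel_map R G E \<epsilon> X \<alpha> f z \<ominus>\<^bsub>borel_cohomology R G E \<epsilon> X \<alpha>\<^esub> borel_map R G E \<epsilon> X \<alpha> g z)
       ` carrier (borel_cohomology R G E \<epsilon> Y \<beta>)"


section \<open>Equivariant homotopic distance\<close>

definition G_homotopic_on ::
    "('g, 'm) monoid_scheme \<Rightarrow> 'x topology \<Rightarrow> ('g \<Rightarrow> 'x \<Rightarrow> 'x) \<Rightarrow>
     'y topology \<Rightarrow> ('g \<Rightarrow> 'y \<Rightarrow> 'y) \<Rightarrow> 'x set \<Rightarrow> ('x \<Rightarrow> 'y) \<Rightarrow> ('x \<Rightarrow> 'y) \<Rightarrow> bool" where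
  "G_homotopic_on G X \<alpha> Y \<beta> U f g \<longleftrightarrow>
     homotopic_with (\<lambda>h. \<forall>\<gamma>\<in>carrier G. \<forall>x\<in>U. h (\<alpha> \<gamma> x) = \<beta> \<gamma> (h x)) (subtopology X U) Y f g"

text \<open>The infimum of the empty set in \<open>enat\<close> is \<open>\<infinity>\<close>.\<close>

definition equivariant_homotopic_distance ::
    "('g, 'm) monoid_scheme \<Rightarrow> 'x topology \<Rightarrow> ('g \<Rightarrow> 'x \<Rightarrow> 'x) \<Rightarrow>
     'y topology \<Rightarrow> ('g \<Rightarrow> 'y \<Rightarrow> 'y) \<Rightarrow> ('x \<Rightarrow> 'y) \<Rightarrow> ('x \<Rightarrow> 'y) \<Rightarrow> enat" where
  "equivariant_homotopic_distance G X \<alpha> Y \<beta> f g =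
     Inf {enat n | n. \<exists>U :: nat \<Rightarrow> 'x set.
       (\<forall>i\<le>n. openin X (U i) \<and> (\<forall>\<gamma>\<in>carrier G. \<forall>x\<in>U i. \<alpha> \<gamma> x \<in> U i) \<and>
              G_homotopic_on G X \<alpha> Y \<beta> (U i) f g) \<and>
       (\<Union>i\<le>n. U i) = topspace X}"

end

theory Submission
  imports Defs
begin

text \<open>
Write \<open>Z\<^sub>h\<close> for the homotopy orbit space of a \<open>G\<close>-space \<open>Z\<close>.  Let \<open>U\<^sub>0, \<dots>, U\<^sub>n\<close> be invariant open sets covering \<open>X\<close>
such that \<open>f\<close> and \<open>g\<close> are \<open>G\<close>-homotopic on each of them.  The images of the sets \<open>EG \<times> U\<^sub>i\<close> form an open
cover of \<open>X\<^sub>h\<close>, and a \<open>G\<close>-homotopy on \<open>U\<^sub>i\<close> descends to a homotopy of maps defined on the image of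
\<open>EG \<times> U\<^sub>i\<close> (\<open>homotopic_homotopy_orbit_map\<close>).  Consequently a difference of the two pullbacks of one
class of \<open>Y\<^sub>h\<close> restricts to \<open>0\<close> on every piece of the cover.  The same is true of the pullback along
\<open>(f, g)\<close> of a class that vanishes on the diagonal, because \<open>(f, g)\<close> is \<open>G\<close>-homotopic on \<open>U\<^sub>i\<close> to \<open>(f, f)\<close>,
which factors through the diagonal.  Both bounds therefore follow from one fact of
Lusternik-Schnirelmann type, \<open>ring_product_zero_if_locally_zero\<close>: if classes restrict to \<open>0\<close> on each
of the \<open>n + 1\<close> members of an open cover, then a product of more than \<open>n\<close> of them is \<open>0\<close>.

This fact is proved with cocycles instead of relative cohomology groups.  A class that restricts to
\<open>0\<close> on \<open>W\<close> has a representative that is zero on all simplices inside \<open>W\<close>.  Assign to the first \<open>n + 1\<close>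
factors representatives that vanish on the successive members of the cover.  A front or back face of
a simplex in \<open>W\<close> lies in \<open>W\<close>, so the product of the representatives vanishes on every simplex that
lies in some member of the cover.  Such a cocycle is a coboundary
(\<open>cocycle_vanishing_on_small_simplices\<close>), since barycentric subdivision deforms all singular chains
into small ones.

The coefficient ring is arbitrary, so that equalities of maps in integral homology do not suffice:
homotopy invariance and the passage to small simplices both need chain homotopies.  These
are constructed by recursion on the degree, choosing at each step a chain that fills a given cycle;
the filling exists because \<open>[0, 1] \<times> \<Delta>\<^sup>p\<close> is contractible in the first case, and because a sufficiently
often subdivided chain is small in the second.  A cochain is then applied to the resulting chains by
means of its additive extension \<open>chain_eval\<close>.
\<close>


section \<open>Front and back faces of singular simplices\<close>

text \<open>
The coefficients may form the zero ring, which the class \<open>ring_1\<close> and its sign rules exclude; signs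
are therefore resolved by parity.
\<close>

lemma minus_one_power_parity:
  "(- 1 :: 'r::{comm_ring, comm_monoid_mult}) ^ k = (if even k then 1 else - 1)"
  by (induction k) auto

definition shift_coords :: "nat \<Rightarrow> (nat \<Rightarrow> real) \<Rightarrow> nat \<Rightarrow> real" where
  "shift_coords p x = (\<lambda>i. if i < p then 0 else x (i - p))"

lemma shift_coords_in_standard_simplex:
  assumes "x \<in> standard_simplex (n - p)" "p \<le> n"
  shows "shift_coords p x \<in> standard_simplex n"
proof -
  have "(\<Sum>i\<le>n. shift_coords p x i) = (\<Sum>i\<in>{p..n}. x (i - p))"
    by (rule sum.mono_neutral_cong_right) (auto simp: shift_coords_def)
  also have "\<dots> = (\<Sum>i\<le>n - p. x i)"
    by (rule sum.reindex_bij_witness[of _ "\<lambda>i. i + p" "\<lambda>i. i - p"]) (use assms in auto)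
  finally show ?thesis
    using assms by (auto simp: standard_simplex_def shift_coords_def)
qed

lemma back_face_eq: "back_face n p \<sigma> = restrict (\<sigma> \<circ> shift_coords p) (standard_simplex (n - p))"
  by (simp add: back_face_def shift_coords_def comp_def)

lemma singular_simplex_front_face:
  assumes "singular_simplex n X \<sigma>" "p \<le> n"
  shows "singular_simplex p X (front_face p \<sigma>)"
  using assms standard_simplex_mono[OF assms(2)]
  unfolding singular_simplex_def front_face_def
  by (auto intro: continuous_map_from_subtopology_mono)

lemma singular_simplex_back_face:
  assumes "singular_simplex n X \<sigma>" "p \<le> n"
  shows "singular_simplex (n - p) X (back_face n p \<sigma>)"
proof -
  have "continuous_map (powertop_real UNIV) (powertop_real UNIV) (shift_coords p)"
    unfolding shift_coords_def continuous_map_componentwise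
    by (auto intro: continuous_map_product_projection)
  then have "continuous_map (subtopology (powertop_real UNIV) (standard_simplex (n - p)))
      (subtopology (powertop_real UNIV) (standard_simplex n)) (shift_coords p)"
    using assms(2) by (auto simp: continuous_map_in_subtopology shift_coords_in_standard_simplex
        intro: continuous_map_from_subtopology)
  with assms(1) show ?thesis
    unfolding singular_simplex_def back_face_eq by (auto intro: continuous_map_compose)
qed

lemma front_face_front_face: "q \<le> p \<Longrightarrow> front_face q (front_face p \<sigma>) = front_face q \<sigma>"
  using standard_simplex_mono[of q p] by (auto simp: front_face_def Int_absorb1)

lemma back_face_back_face:
  assumes "q \<le> p" "p \<le> n"
  shows "back_face (n - q) (p - q) (back_face n q \<sigma>) = back_face n p \<sigma>"
proof -
  have "shift_coords q (shift_coords (p - q) x) = shift_coords p x" for x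
    using assms by (auto simp: shift_coords_def fun_eq_iff)
  moreover have "shift_coords (p - q) x \<in> standard_simplex (n - q)" if "x \<in> standard_simplex (n - p)" for x
    using that assms by (intro shift_coords_in_standard_simplex) auto
  ultimately show ?thesis
    using assms by (intro ext) (auto simp: back_face_eq)
qed

lemma front_face_back_face:
  assumes "q \<le> p" "p \<le> n"
  shows "front_face (p - q) (back_face n q \<sigma>) = back_face p q (front_face p \<sigma>)"
  using assms standard_simplex_mono[of "p - q" "n - q", OF diff_le_mono]
  by (intro ext) (auto simp: back_face_eq front_face_def shift_coords_in_standard_simplex)

lemma front_face_self: "singular_simplex n X \<sigma> \<Longrightarrow> front_face n \<sigma> = \<sigma>"
  by (simp add: singular_simplex_def front_face_def extensional_restrict)

lemma back_face_0: "singular_simplex n X \<sigma> \<Longrightarrow> back_face n 0 \<sigma> = \<sigma>"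
  by (simp add: singular_simplex_def back_face_def extensional_restrict)

lemma front_face_simplex_map:
  "p \<le> n \<Longrightarrow> front_face p (simplex_map n f \<sigma>) = simplex_map p f (front_face p \<sigma>)"
  using standard_simplex_mono[of p n] by (intro ext) (auto simp: front_face_def simplex_map_def)

lemma back_face_simplex_map:
  "p \<le> n \<Longrightarrow> back_face n p (simplex_map n f \<sigma>) = simplex_map (n - p) f (back_face n p \<sigma>)"
  by (intro ext) (auto simp: back_face_eq simplex_map_def shift_coords_in_standard_simplex)

text \<open>
This and the next three lemmas are the identities behind the Leibniz rule.  Deleting a vertex \<open>k \<le> p\<close>
turns the cut at \<open>p + 1\<close> into the cut at \<open>p\<close> and takes a face of the front only; deleting a vertex \<open>k > p\<close>
keeps the cut at \<open>p\<close> and takes a face of the back only.  The ranges overlap (\<open>k = p + 1\<close> in front, \<open>k = p\<close> in the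
back); the overlaps produce two equal terms that cancel.
\<close>

lemma front_face_singular_face_low:
  assumes "k \<le> Suc p" "p \<le> n"
  shows "front_face p (singular_face (Suc n) k \<sigma>) = singular_face (Suc p) k (front_face (Suc p) \<sigma>)"
  using assms standard_simplex_mono[of p n] simplical_face_in_standard_simplex[of "Suc p" k]
  by (intro ext) (auto simp: front_face_def singular_face_def)

lemma front_face_singular_face_high:
  assumes "p < k" "p \<le> n"
  shows "front_face p (singular_face (Suc n) k \<sigma>) = front_face p \<sigma>"
proof -
  have "simplical_face k x = x" if "x \<in> standard_simplex p" for x :: "nat \<Rightarrow> real"
    using that assms by (auto simp: standard_simplex_def simplical_face_def fun_eq_iff)
  then show ?thesis
    using assms standard_simplex_mono[of p n]
    by (intro ext) (auto simp: front_face_def singular_face_def)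
qed

lemma back_face_singular_face_low:
  assumes "k \<le> p" "p \<le> n"
  shows "back_face n p (singular_face (Suc n) k \<sigma>) = back_face (Suc n) (Suc p) \<sigma>"
proof -
  have "simplical_face k (shift_coords p x) = shift_coords (Suc p) x" for x
    using assms by (auto simp: simplical_face_def shift_coords_def fun_eq_iff)
  then show ?thesis
    using assms by (intro ext) (auto simp: back_face_eq singular_face_def shift_coords_in_standard_simplex)
qed

lemma back_face_singular_face_high:
  assumes "p \<le> k" "k \<le> Suc n" "p \<le> n"
  shows "back_face n p (singular_face (Suc n) k \<sigma>) =
    singular_face (Suc n - p) (k - p) (back_face (Suc n) p \<sigma>)"
proof -
  have "simplical_face k (shift_coords p x) = shift_coords p (simplical_face (k - p) x)" for x
    using assms by (auto simp: simplical_face_def shift_coords_def fun_eq_iff diff_right_commute)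
  moreover have "simplical_face (k - p) x \<in> standard_simplex (Suc n - p)"
    if "x \<in> standard_simplex (n - p)" for x
    using simplical_face_in_standard_simplex[of "Suc n - p" "k - p" x] that assms
    by auto
  ultimately show ?thesis
    using assms by (intro ext) (auto simp: back_face_eq singular_face_def shift_coords_in_standard_simplex)
qed


section \<open>Evaluation of cochains on chains\<close>

text \<open>
The additive extension of a function on generators to the free abelian group.  It is selected by its
universal property because integer multiples in terms of \<open>of_int\<close> would require \<open>0 \<noteq> 1\<close> in the
coefficients.
\<close>

definition chain_eval :: "('b \<Rightarrow> 'r::ab_group_add) \<Rightarrow> ('b \<Rightarrow>\<^sub>0 int) \<Rightarrow> 'r" where
  "chain_eval \<phi> = (SOME h. (\<forall>z w. h (z - w) = h z - h w) \<and> (\<forall>x. h (frag_of x) = \<phi> x))"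

lemma chain_eval_exists:
  fixes \<phi> :: "'b \<Rightarrow> 'r::ab_group_add"
  shows "\<exists>h. (\<forall>z w. h (z - w) = h z - h w) \<and> (\<forall>x. h (frag_of x) = \<phi> x)"
proof -
  let ?A = "\<lparr>carrier = UNIV, monoid.mult = (+), one = 0\<rparr> :: 'r monoid"
  interpret A: comm_group ?A
  proof (rule comm_groupI)
    fix x assume "x \<in> carrier ?A"
    show "\<exists>y\<in>carrier ?A. y \<otimes>\<^bsub>?A\<^esub> x = \<one>\<^bsub>?A\<^esub>"
      by (rule bexI[of _ "- x"]) auto
  qed (auto simp: ac_simps)
  obtain h where hom: "h \<in> hom (free_Abelian_group UNIV) ?A" and "\<And>x. h (frag_of x) = \<phi> x"
    using A.free_Abelian_group_universal[of \<phi> UNIV] by auto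
  moreover have "h (z - w) = h z - h w" for z w
  proof -
    have "h ((z - w) + w) = h (z - w) + h w"
      using hom_mult[OF hom, of "z - w" w] by simp
    then show ?thesis by simp
  qed
  ultimately show ?thesis by blast
qed

lemma chain_eval_diff: "chain_eval \<phi> (z - w) = chain_eval \<phi> z - chain_eval \<phi> w"
  and chain_eval_of [simp]: "chain_eval \<phi> (frag_of x) = \<phi> x"
  using someI_ex[OF chain_eval_exists[of \<phi>]] unfolding chain_eval_def by auto

lemma chain_eval_0 [simp]: "chain_eval \<phi> 0 = 0"
  using chain_eval_diff[of \<phi> 0 0] by simp

lemma chain_eval_minus: "chain_eval \<phi> (- z) = - chain_eval \<phi> z"
  using chain_eval_diff[of \<phi> 0 z] by simp

lemma chain_eval_add: "chain_eval \<phi> (z + w) = chain_eval \<phi> z + chain_eval \<phi> w"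
  using chain_eval_diff[of \<phi> z "- w"] by (simp add: chain_eval_minus)

lemma chain_eval_sum: "chain_eval \<phi> (sum z I) = (\<Sum>i\<in>I. chain_eval \<phi> (z i))"
  by (induction I rule: infinite_finite_induct) (auto simp: chain_eval_add)

lemma chain_eval_sign:
  fixes \<phi> :: "'b \<Rightarrow> 'r::{comm_ring, comm_monoid_mult}"
  shows "chain_eval \<phi> (frag_cmul ((- 1) ^ k) z) = (- 1) ^ k * chain_eval \<phi> z"
  by (cases "even k") (auto simp: minus_one_power_parity chain_eval_minus)

lemma chain_eval_cong:
  assumes "\<And>x. x \<in> Poly_Mapping.keys z \<Longrightarrow> \<phi> x = \<psi> x"
  shows "chain_eval \<phi> z = chain_eval \<psi> z"
proof -
  have "Poly_Mapping.keys z \<subseteq> {x. \<phi> x = \<psi> x}"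
    using assms by auto
  then show ?thesis
    by (induction z rule: frag_induction) (auto simp: chain_eval_diff)
qed

lemma chain_eval_zero_fun [simp]: "chain_eval (\<lambda>x. 0) z = 0"
proof -
  have "Poly_Mapping.keys z \<subseteq> UNIV" by simp
  then show ?thesis
    by (induction z rule: frag_induction) (auto simp: chain_eval_diff)
qed

lemma chain_eval_eq_0:
  "(\<And>x. x \<in> Poly_Mapping.keys z \<Longrightarrow> \<phi> x = 0) \<Longrightarrow> chain_eval \<phi> z = 0"
  using chain_eval_cong[of z \<phi> "\<lambda>x. 0"] by simp


section \<open>The coboundary and the cup product\<close>

lemma coboundary_degree_0 [simp]: "coboundary X a 0 \<sigma> = 0"
  by (simp add: coboundary_def)

lemma coboundary_eq_chain_eval:
  assumes "singular_simplex n X \<sigma>"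
  shows "coboundary X a n \<sigma> = chain_eval (a (n - 1)) (chain_boundary n (frag_of \<sigma>))"
  using assms
  by (auto simp: coboundary_def chain_boundary_of chain_eval_sum chain_eval_sign)

text \<open>
The coboundary is the transpose of the boundary on all singular chains; chain homotopies can thus be
transposed to cochains, and \<open>\<delta>\<delta> = 0\<close> follows from \<open>\<partial>\<partial> = 0\<close>.
\<close>

lemma chain_eval_coboundary:
  assumes "singular_chain n X z"
  shows "chain_eval (coboundary X a n) z = chain_eval (a (n - 1)) (chain_boundary n z)"
  using assms unfolding singular_chain_def
  by (induction z rule: frag_induction)
    (auto simp: chain_eval_diff chain_boundary_diff coboundary_eq_chain_eval)

lemma coboundary_coboundary: "coboundary X (coboundary X a) = (\<lambda>n \<sigma>. 0)"
proof (intro ext)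
  fix n \<sigma>
  show "coboundary X (coboundary X a) n \<sigma> = 0"
  proof (cases "n \<noteq> 0 \<and> singular_simplex n X \<sigma>")
    case True
    then have "singular_chain n X (frag_of \<sigma>)"
      by (simp add: singular_chain_of)
    then have "singular_chain (n - 1) X (chain_boundary n (frag_of \<sigma>))"
      and "chain_boundary (n - 1) (chain_boundary n (frag_of \<sigma>)) = 0"
      using chain_boundary_boundary singular_chain_boundary by force+
    with True show ?thesis
      by (simp add: coboundary_eq_chain_eval chain_eval_coboundary)
  qed (auto simp: coboundary_def)
qed

lemma coboundary_add:
  "coboundary X (\<lambda>n \<sigma>. a n \<sigma> + b n \<sigma>) = (\<lambda>n \<sigma>. coboundary X a n \<sigma> + coboundary X b n \<sigma>)"
  by (auto simp: coboundary_def fun_eq_iff sum.distrib distrib_left)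

lemma coboundary_minus: "coboundary X (\<lambda>n \<sigma>. - a n \<sigma>) = (\<lambda>n \<sigma>. - coboundary X a n \<sigma>)"
  by (auto simp: coboundary_def fun_eq_iff sum_negf)

lemma coboundary_zero [simp]: "coboundary X (\<lambda>n \<sigma>. 0) = (\<lambda>n \<sigma>. 0)"
  by (auto simp: coboundary_def fun_eq_iff)

text \<open>
The sign \<open>(-1)\<^sup>p\<close> of the Leibniz rule depends on the degree of the left factor, and cochains here are not
homogeneous; the sign is therefore built into this involution of the left factor.
\<close>

definition alternate ::
    "('a, 'r::{comm_ring, comm_monoid_mult}) cochain \<Rightarrow> ('a, 'r) cochain" where
  "alternate a = (\<lambda>n \<sigma>. (- 1) ^ n * a n \<sigma>)"

lemma alternate_alternate [simp]: "alternate (alternate a) = a"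
  by (auto simp: alternate_def fun_eq_iff minus_one_power_parity)

lemma alternate_zero [simp]: "alternate (\<lambda>n \<sigma>. 0) = (\<lambda>n \<sigma>. 0)"
  by (simp add: alternate_def)

lemma coboundary_alternate: "coboundary X (alternate a) = (\<lambda>n \<sigma>. - alternate (coboundary X a) n \<sigma>)"
proof (intro ext)
  fix n \<sigma>
  show "coboundary X (alternate a) n \<sigma> = - alternate (coboundary X a) n \<sigma>"
    by (cases n) (auto simp: coboundary_def alternate_def sum_distrib_left algebra_simps sum_negf
        simp del: sum.atMost_Suc)
qed

text \<open>
The Leibniz rule \<open>\<delta>(a \<union> b) = \<delta>a \<union> b \<plusminus> a \<union> \<delta>b\<close>.  In the double sum for the left side, the faces \<open>d\<^sub>k\<close> with
\<open>k \<le> p\<close> belong to the front (\<open>A\<close>) and those with \<open>k > p\<close> to the back (\<open>B\<close>).  Each summand on the right has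
one more face, the one opposite to the shared vertex, with values \<open>- E\<close> and \<open>E\<close>.
\<close>

lemma coboundary_cup:
  "coboundary X (cup X a b) =
    (\<lambda>n \<sigma>. cup X (coboundary X a) b n \<sigma> + cup X (alternate a) (coboundary X b) n \<sigma>)"
proof (intro ext)
  note sum.atMost_Suc [simp del]
  fix n \<sigma>
  show "coboundary X (cup X a b) n \<sigma> =
      cup X (coboundary X a) b n \<sigma> + cup X (alternate a) (coboundary X b) n \<sigma>"
  proof (cases "singular_simplex n X \<sigma>")
    case False
    then show ?thesis by (simp add: coboundary_def cup_def)
  next
    case \<sigma>: True
    show ?thesis
    proof (cases n)
      case 0
      then show ?thesis by (simp add: coboundary_def cup_def)
    next
      case (Suc m)
      define A where "A = (\<lambda>p. \<Sum>k\<le>p. (- 1) ^ k * a p (singular_face (Suc p) k (front_face (Suc p) \<sigma>)) *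
          b (m - p) (back_face (Suc m) (Suc p) \<sigma>))"
      define B where "B = (\<lambda>p. \<Sum>k\<in>{Suc p..Suc m}. (- 1) ^ k * a p (front_face p \<sigma>) *
          b (m - p) (singular_face (Suc m - p) (k - p) (back_face (Suc m) p \<sigma>)))"
      \<comment> \<open>The summand in which the vertex shared by the front and the back is deleted.\<close>
      define E where "E = (\<lambda>p. (- 1) ^ p * a p (front_face p \<sigma>) * b (m - p) (back_face (Suc m) (Suc p) \<sigma>))"
      have face: "singular_simplex m X (singular_face (Suc m) k \<sigma>)" if "k \<le> Suc m" for k
        using singular_simplex_singular_face[of "Suc m" X \<sigma> k] that \<sigma> Suc by simp
      have "coboundary X (cup X a b) n \<sigma> = (\<Sum>k\<le>Suc m. \<Sum>p\<le>m. (- 1) ^ k *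
          (a p (front_face p (singular_face (Suc m) k \<sigma>)) *
           b (m - p) (back_face m p (singular_face (Suc m) k \<sigma>))))"
        using \<sigma> Suc face by (simp add: coboundary_def cup_def sum_distrib_left)
      also have "\<dots> = (\<Sum>p\<le>m. \<Sum>k\<le>Suc m. (- 1) ^ k *
          (a p (front_face p (singular_face (Suc m) k \<sigma>)) *
           b (m - p) (back_face m p (singular_face (Suc m) k \<sigma>))))"
        by (rule sum.swap)
      also have "\<dots> = (\<Sum>p\<le>m. A p + B p)"
      proof (rule sum.cong[OF refl])
        fix p assume "p \<in> {..m}"
        then have p: "p \<le> m" and split: "{..Suc m} = {..p} \<union> {Suc p..Suc m}" by auto
        show "(\<Sum>k\<le>Suc m. (- 1) ^ k *
          (a p (front_face p (singular_face (Suc m) k \<sigma>)) *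
           b (m - p) (back_face m p (singular_face (Suc m) k \<sigma>)))) = A p + B p"
          unfolding split A_def B_def using p
          by (subst sum.union_disjoint)
            (auto intro!: arg_cong2[where f = "(+)"] sum.cong simp: front_face_singular_face_low
              front_face_singular_face_high back_face_singular_face_low back_face_singular_face_high mult.assoc)
      qed
      finally have lhs: "coboundary X (cup X a b) n \<sigma> = (\<Sum>p\<le>m. A p + B p)" .
      have "cup X (coboundary X a) b n \<sigma> = (\<Sum>p\<le>m. coboundary X a (Suc p) (front_face (Suc p) \<sigma>) *
          b (m - p) (back_face (Suc m) (Suc p) \<sigma>))"
        using \<sigma> Suc by (simp add: cup_def sum.atMost_Suc_shift coboundary_degree_0)
      also have "\<dots> = (\<Sum>p\<le>m. A p - E p)"
      proof (rule sum.cong[OF refl])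
        fix p assume "p \<in> {..m}"
        then have "singular_simplex (Suc p) X (front_face (Suc p) \<sigma>)"
          and "singular_face (Suc p) (Suc p) (front_face (Suc p) \<sigma>) = front_face p \<sigma>"
          using singular_simplex_front_face[OF \<sigma>, of "Suc p"] Suc
            front_face_singular_face_low[of "Suc p" p m \<sigma>] front_face_singular_face_high[of p "Suc p" m \<sigma>]
          by auto
        then show "coboundary X a (Suc p) (front_face (Suc p) \<sigma>) * b (m - p) (back_face (Suc m) (Suc p) \<sigma>)
            = A p - E p"
          by (simp add: coboundary_def A_def E_def sum.atMost_Suc algebra_simps sum_distrib_left)
      qed
      finally have rhs1: "cup X (coboundary X a) b n \<sigma> = (\<Sum>p\<le>m. A p - E p)" .
      have "cup X (alternate a) (coboundary X b) n \<sigma> = (\<Sum>p\<le>m. (- 1) ^ p * a p (front_face p \<sigma>) *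
          coboundary X b (Suc m - p) (back_face (Suc m) p \<sigma>))"
        using \<sigma> Suc by (simp add: cup_def sum.atMost_Suc coboundary_degree_0 alternate_def)
      also have "\<dots> = (\<Sum>p\<le>m. E p + B p)"
      proof (rule sum.cong[OF refl])
        fix p assume "p \<in> {..m}"
        then have p: "p \<le> m" by simp
        have s: "singular_simplex (Suc m - p) X (back_face (Suc m) p \<sigma>)"
          and f: "singular_face (Suc m - p) 0 (back_face (Suc m) p \<sigma>) = back_face (Suc m) (Suc p) \<sigma>"
          using singular_simplex_back_face[OF \<sigma>, of p] Suc p
            back_face_singular_face_low[of p p m \<sigma>] back_face_singular_face_high[of p p m \<sigma>]
          by auto
        have split: "{..Suc m - p} = insert 0 {1..Suc m - p}" by auto
        \<comment> \<open>The face \<open>j\<close> of the back comes from the face \<open>k = p + j\<close> of \<open>\<sigma>\<close>; the face \<open>j = 0\<close> gives \<open>E\<close>.\<close>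
        have "(\<Sum>j\<in>{1..Suc m - p}. (- 1) ^ p * a p (front_face p \<sigma>) *
            ((- 1) ^ j * b (m - p) (singular_face (Suc m - p) j (back_face (Suc m) p \<sigma>)))) = B p"
          unfolding B_def
          by (rule sum.reindex_bij_witness[of _ "\<lambda>k. k - p" "\<lambda>j. j + p"])
            (use p in \<open>auto simp: power_add algebra_simps\<close>)
        moreover have "Suc m - p - 1 = m - p" by simp
        ultimately show "(- 1) ^ p * a p (front_face p \<sigma>) *
            coboundary X b (Suc m - p) (back_face (Suc m) p \<sigma>) = E p + B p"
          using s f p by (simp add: coboundary_def split sum_distrib_left E_def distrib_left)
      qed
      finally have "cup X (alternate a) (coboundary X b) n \<sigma> = (\<Sum>p\<le>m. E p + B p)" .
      with lhs rhs1 show ?thesis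
        by (simp add: sum.distrib[symmetric])
    qed
  qed
qed

lemma cup_add_left: "cup X (\<lambda>n \<sigma>. a n \<sigma> + b n \<sigma>) c = (\<lambda>n \<sigma>. cup X a c n \<sigma> + cup X b c n \<sigma>)"
  by (auto simp: cup_def fun_eq_iff sum.distrib distrib_right)

lemma cup_add_right: "cup X c (\<lambda>n \<sigma>. a n \<sigma> + b n \<sigma>) = (\<lambda>n \<sigma>. cup X c a n \<sigma> + cup X c b n \<sigma>)"
  by (auto simp: cup_def fun_eq_iff sum.distrib distrib_left)

lemma cup_zero_left [simp]: "cup X (\<lambda>n \<sigma>. 0) a = (\<lambda>n \<sigma>. 0)"
  and cup_zero_right [simp]: "cup X a (\<lambda>n \<sigma>. 0) = (\<lambda>n \<sigma>. 0)"
  by (auto simp: cup_def fun_eq_iff)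

text \<open>
Both iterated products sum over all ways of cutting a simplex at two vertices \<open>q \<le> p\<close>; the second cut
is \<open>r = p - q\<close> when counted from the first one.
\<close>

lemma cup_assoc: "cup X (cup X a b) c = cup X a (cup X b c)"
proof (intro ext)
  fix n \<sigma>
  show "cup X (cup X a b) c n \<sigma> = cup X a (cup X b c) n \<sigma>"
  proof (cases "singular_simplex n X \<sigma>")
    case \<sigma>: True
    have "cup X (cup X a b) c n \<sigma> = (\<Sum>p\<le>n. \<Sum>q\<le>p. a q (front_face q \<sigma>) *
        b (p - q) (back_face p q (front_face p \<sigma>)) * c (n - p) (back_face n p \<sigma>))"
      using \<sigma> by (auto simp: cup_def singular_simplex_front_face sum_distrib_right
          front_face_front_face intro!: sum.cong)
    also have "\<dots> = (\<Sum>(p, q)\<in>(SIGMA p:{..n}. {..p}). a q (front_face q \<sigma>) *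
        b (p - q) (back_face p q (front_face p \<sigma>)) * c (n - p) (back_face n p \<sigma>))"
      by (rule sum.Sigma) auto
    also have "\<dots> = (\<Sum>(q, r)\<in>(SIGMA q:{..n}. {..n - q}). a q (front_face q \<sigma>) *
        (b r (front_face r (back_face n q \<sigma>)) * c (n - q - r) (back_face (n - q) r (back_face n q \<sigma>))))"
    proof (rule sum.reindex_bij_witness[of _ "\<lambda>(q, r). (q + r, q)" "\<lambda>(p, q). (q, p - q)"], goal_cases)
      case (5 pq)
      then obtain p q where pq: "pq = (p, q)" "q \<le> p" "p \<le> n" by auto
      then show ?case
        using front_face_back_face[of q p n \<sigma>] back_face_back_face[of q p n \<sigma>]
        by (simp add: mult.assoc)
    qed auto
    also have "\<dots> = (\<Sum>q\<le>n. \<Sum>r\<le>n - q. a q (front_face q \<sigma>) *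
        (b r (front_face r (back_face n q \<sigma>)) * c (n - q - r) (back_face (n - q) r (back_face n q \<sigma>))))"
      by (rule sum.Sigma[symmetric]) auto
    also have "\<dots> = cup X a (cup X b c) n \<sigma>"
      using \<sigma> by (auto simp: cup_def singular_simplex_back_face sum_distrib_left intro!: sum.cong)
    finally show ?thesis .
  qed (simp add: cup_def)
qed

definition unit_cochain :: "'a topology \<Rightarrow> ('a, 'r::{comm_ring, comm_monoid_mult}) cochain" where
  "unit_cochain X = (\<lambda>n \<sigma>. if n = 0 \<and> singular_simplex 0 X \<sigma> then 1 else 0)"

lemma cup_unit_left:
  assumes "a \<in> cochains R X"
  shows "cup X (unit_cochain X) a = a"
proof (intro ext)
  fix n \<sigma>
  have "(\<Sum>p\<le>n. unit_cochain X p (front_face p \<sigma>) * a (n - p) (back_face n p \<sigma>)) = a n \<sigma>"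
    if \<sigma>: "singular_simplex n X \<sigma>"
  proof -
    have "(\<Sum>p\<le>n. unit_cochain X p (front_face p \<sigma>) * a (n - p) (back_face n p \<sigma>)) =
        (\<Sum>p\<in>{0}. unit_cochain X p (front_face p \<sigma>) * a (n - p) (back_face n p \<sigma>))"
      by (rule sum.mono_neutral_right) (auto simp: unit_cochain_def)
    also have "\<dots> = a n \<sigma>"
      using \<sigma> singular_simplex_front_face[OF \<sigma>, of 0] by (simp add: unit_cochain_def back_face_0)
    finally show ?thesis .
  qed
  with assms show "cup X (unit_cochain X) a n \<sigma> = a n \<sigma>"
    by (auto simp: cup_def cochains_def)
qed

lemma cup_unit_right:
  assumes "a \<in> cochains R X"
  shows "cup X a (unit_cochain X) = a"
proof (intro ext)
  fix n \<sigma>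
  have "(\<Sum>p\<le>n. a p (front_face p \<sigma>) * unit_cochain X (n - p) (back_face n p \<sigma>)) = a n \<sigma>"
    if \<sigma>: "singular_simplex n X \<sigma>"
  proof -
    have "(\<Sum>p\<le>n. a p (front_face p \<sigma>) * unit_cochain X (n - p) (back_face n p \<sigma>)) =
        (\<Sum>p\<in>{n}. a p (front_face p \<sigma>) * unit_cochain X (n - p) (back_face n p \<sigma>))"
      by (rule sum.mono_neutral_right) (auto simp: unit_cochain_def)
    also have "\<dots> = a n \<sigma>"
      using \<sigma> singular_simplex_back_face[OF \<sigma>, of n] by (simp add: unit_cochain_def front_face_self)
    finally show ?thesis .
  qed
  with assms show "cup X a (unit_cochain X) n \<sigma> = a n \<sigma>"
    by (auto simp: cup_def cochains_def)
qed

lemma zero_in_cochains [simp]: "(\<lambda>n \<sigma>. 0) \<in> cochains R X"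
  by (simp add: cochains_def)

lemma add_in_cochains:
  assumes "a \<in> cochains R X" "b \<in> cochains R X"
  shows "(\<lambda>n \<sigma>. a n \<sigma> + b n \<sigma>) \<in> cochains R X"
proof -
  have "{n. (\<lambda>\<sigma>. a n \<sigma> + b n \<sigma>) \<noteq> (\<lambda>\<sigma>. 0)} \<subseteq> {n. a n \<noteq> (\<lambda>\<sigma>. 0)} \<union> {n. b n \<noteq> (\<lambda>\<sigma>. 0)}"
    by (auto simp: fun_eq_iff)
  with assms show ?thesis
    by (auto simp: cochains_def intro: finite_subset)
qed

lemma minus_in_cochains: "a \<in> cochains R X \<Longrightarrow> (\<lambda>n \<sigma>. - a n \<sigma>) \<in> cochains R X"
  by (simp add: cochains_def fun_eq_iff)

lemma alternate_in_cochains: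
  assumes "a \<in> cochains R X" shows "alternate a \<in> cochains R X"
proof -
  have "{n. alternate a n \<noteq> (\<lambda>\<sigma>. 0)} \<subseteq> {n. a n \<noteq> (\<lambda>\<sigma>. 0)}"
    by (auto simp: alternate_def)
  with assms show ?thesis
    by (auto simp: cochains_def alternate_def intro: finite_subset)
qed

lemma unit_in_cochains:
  "(unit_cochain X :: ('a, 'b::{comm_ring, comm_monoid_mult}) cochain) \<in> cochains R X"
proof -
  have "{n. (unit_cochain X :: ('a, 'b) cochain) n \<noteq> (\<lambda>\<sigma>. 0)} \<subseteq> {0}"
    by (auto simp: unit_cochain_def)
  then have "finite {n. (unit_cochain X :: ('a, 'b) cochain) n \<noteq> (\<lambda>\<sigma>. 0)}"
    by (rule finite_subset) simp
  then show ?thesis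
    by (auto simp: cochains_def unit_cochain_def)
qed

lemma cup_in_cochains:
  assumes "a \<in> cochains R X" "b \<in> cochains R X"
  shows "cup X a b \<in> cochains R X"
proof -
  let ?S = "\<lambda>c :: ('a, 'b) cochain. {n. c n \<noteq> (\<lambda>\<sigma>. 0)}"
  have "?S (cup X a b) \<subseteq> (\<lambda>(p, q). p + q) ` (?S a \<times> ?S b)"
  proof
    fix n assume "n \<in> ?S (cup X a b)"
    then obtain \<sigma> where "cup X a b n \<sigma> \<noteq> 0" by (auto simp: fun_eq_iff)
    then have "(\<Sum>p\<le>n. a p (front_face p \<sigma>) * b (n - p) (back_face n p \<sigma>)) \<noteq> 0"
      by (simp add: cup_def split: if_splits)
    then obtain p where "p \<le> n" "a p (front_face p \<sigma>) * b (n - p) (back_face n p \<sigma>) \<noteq> 0"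
      by (metis (no_types, lifting) atMost_iff sum.neutral)
    then have "p \<in> ?S a" "n - p \<in> ?S b" "n = p + (n - p)"
      by auto
    then show "n \<in> (\<lambda>(p, q). p + q) ` (?S a \<times> ?S b)"
      by (metis (mono_tags, lifting) SigmaI image_eqI old.prod.case)
  qed
  moreover have "finite ((\<lambda>(p, q). p + q) ` (?S a \<times> ?S b))"
    using assms by (simp add: cochains_def)
  ultimately show ?thesis
    by (auto simp: cochains_def cup_def dest: finite_subset)
qed

lemma coboundary_in_cochains:
  assumes "a \<in> cochains R X" shows "coboundary X a \<in> cochains R X"
proof -
  have "{n. coboundary X a n \<noteq> (\<lambda>\<sigma>. 0)} \<subseteq> Suc ` {n. a n \<noteq> (\<lambda>\<sigma>. 0)}"
  proof
    fix n assume "n \<in> {n. coboundary X a n \<noteq> (\<lambda>\<sigma>. 0)}"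
    then obtain \<sigma> where \<sigma>: "coboundary X a n \<sigma> \<noteq> 0" by (auto simp: fun_eq_iff)
    then obtain m where "n = Suc m" by (cases n) (auto simp: coboundary_def)
    moreover have "a m \<noteq> (\<lambda>\<sigma>. 0)"
      using \<sigma> \<open>n = Suc m\<close> by (auto simp: coboundary_def split: if_splits)
    ultimately show "n \<in> Suc ` {n. a n \<noteq> (\<lambda>\<sigma>. 0)}" by auto
  qed
  with assms show ?thesis
    by (auto simp: cochains_def coboundary_def dest: finite_subset)
qed


section \<open>The cohomology ring and its functoriality\<close>

lemma cocycle_ring_simps:
  "carrier (cocycle_ring R X) = {c \<in> cochains R X. coboundary X c = (\<lambda>n \<sigma>. 0)}"
  "a \<otimes>\<^bsub>cocycle_ring R X\<^esub> b = cup X a b"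
  "\<one>\<^bsub>cocycle_ring R X\<^esub> = unit_cochain X"
  "\<zero>\<^bsub>cocycle_ring R X\<^esub> = (\<lambda>n \<sigma>. 0)"
  "a \<oplus>\<^bsub>cocycle_ring R X\<^esub> b = (\<lambda>n \<sigma>. a n \<sigma> + b n \<sigma>)"
  by (simp_all add: cocycle_ring_def unit_cochain_def)

lemma coboundary_unit [simp]: "coboundary X (unit_cochain X) = (\<lambda>n \<sigma>. 0)"
proof (intro ext)
  fix n \<sigma>
  show "coboundary X (unit_cochain X) n \<sigma> = 0"
  proof (cases "n = 1")
    case True
    then show ?thesis
      using singular_simplex_singular_face[of 1 X \<sigma>]
      by (auto simp: coboundary_def unit_cochain_def)
  qed (auto simp: coboundary_def unit_cochain_def intro!: sum.neutral)
qed

lemma ring_cocycle_ring: "ring (cocycle_ring R X)"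
proof (rule ringI)
  show "abelian_group (cocycle_ring R X)"
  proof (rule abelian_groupI)
    fix a assume a: "a \<in> carrier (cocycle_ring R X)"
    then show "\<exists>b\<in>carrier (cocycle_ring R X). b \<oplus>\<^bsub>cocycle_ring R X\<^esub> a = \<zero>\<^bsub>cocycle_ring R X\<^esub>"
      by (intro bexI[of _ "\<lambda>n \<sigma>. - a n \<sigma>"])
        (auto simp: cocycle_ring_simps minus_in_cochains coboundary_minus)
  qed (auto simp: cocycle_ring_simps add_in_cochains coboundary_add ac_simps)
  show "monoid (cocycle_ring R X)"
    by (rule monoidI)
      (auto simp: cocycle_ring_simps cup_in_cochains coboundary_cup cup_assoc unit_in_cochains
        intro: cup_unit_left cup_unit_right)
qed (auto simp: cocycle_ring_simps cup_add_left cup_add_right)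

lemma a_inv_cocycle_ring:
  assumes "a \<in> carrier (cocycle_ring R X)"
  shows "\<ominus>\<^bsub>cocycle_ring R X\<^esub> a = (\<lambda>n \<sigma>. - a n \<sigma>)"
proof -
  interpret ring "cocycle_ring R X" by (rule ring_cocycle_ring)
  show ?thesis
    using assms
    by (intro minus_equality) (auto simp: cocycle_ring_simps minus_in_cochains coboundary_minus)
qed

lemma a_minus_cocycle_ring:
  assumes "a \<in> carrier (cocycle_ring R X)" "b \<in> carrier (cocycle_ring R X)"
  shows "a \<ominus>\<^bsub>cocycle_ring R X\<^esub> b = (\<lambda>n \<sigma>. a n \<sigma> - b n \<sigma>)"
  using assms by (simp add: a_minus_def a_inv_cocycle_ring) (simp add: cocycle_ring_simps)

lemma coboundaries_subset: "coboundaries R X \<subseteq> carrier (cocycle_ring R X)"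
  by (auto simp: coboundaries_def cocycle_ring_simps coboundary_coboundary coboundary_in_cochains)

text \<open>
Absorption is the Leibniz rule: if \<open>b\<close> is a cocycle, then \<open>\<delta>c \<union> b = \<delta>(c \<union> b)\<close>, and \<open>b \<union> \<delta>c\<close> is \<open>\<delta>(b' \<union> c)\<close>
for the alternated cocycle \<open>b'\<close>.
\<close>

lemma ideal_coboundaries: "ideal (coboundaries R X) (cocycle_ring R X)"
proof (rule idealI[OF ring_cocycle_ring])
  interpret ring "cocycle_ring R X" by (rule ring_cocycle_ring)
  show "subgroup (coboundaries R X) (add_monoid (cocycle_ring R X))"
  proof (rule group.subgroupI[OF a_group])
    show "coboundaries R X \<subseteq> carrier (add_monoid (cocycle_ring R X))"
      using coboundaries_subset by simp
    show "coboundaries R X \<noteq> {}"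
      using zero_in_cochains[of R X] unfolding coboundaries_def by blast
  next
    fix a assume a: "a \<in> coboundaries R X"
    then obtain c where "c \<in> cochains R X" "a = coboundary X c"
      by (auto simp: coboundaries_def)
    then have "(\<lambda>n \<sigma>. - a n \<sigma>) \<in> coboundaries R X"
      by (auto simp: coboundaries_def coboundary_minus minus_in_cochains
          intro!: image_eqI[of _ _ "\<lambda>n \<sigma>. - c n \<sigma>"])
    then show "inv\<^bsub>add_monoid (cocycle_ring R X)\<^esub> a \<in> coboundaries R X"
      using a_inv_cocycle_ring[OF subsetD[OF coboundaries_subset a]] by (simp add: a_inv_def)
  next
    fix a b assume "a \<in> coboundaries R X" "b \<in> coboundaries R X"
    then obtain c d where "c \<in> cochains R X" "a = coboundary X c" "d \<in> cochains R X" "b = coboundary X d"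
      by (auto simp: coboundaries_def)
    then have "(\<lambda>n \<sigma>. a n \<sigma> + b n \<sigma>) \<in> coboundaries R X"
      by (auto simp: coboundaries_def coboundary_add add_in_cochains
          intro!: image_eqI[of _ _ "\<lambda>n \<sigma>. c n \<sigma> + d n \<sigma>"])
    then show "a \<otimes>\<^bsub>add_monoid (cocycle_ring R X)\<^esub> b \<in> coboundaries R X"
      by (simp add: cocycle_ring_simps)
  qed
next
  fix a b assume "a \<in> coboundaries R X" and b: "b \<in> carrier (cocycle_ring R X)"
  then obtain c where c: "c \<in> cochains R X" "a = coboundary X c"
    by (auto simp: coboundaries_def)
  have "coboundary X (cup X (alternate b) c) = cup X b a"
    using b c by (auto simp: coboundary_cup coboundary_alternate cocycle_ring_simps)
  then show "b \<otimes>\<^bsub>cocycle_ring R X\<^esub> a \<in> coboundaries R X"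
    using b c by (auto simp: coboundaries_def cocycle_ring_simps alternate_in_cochains cup_in_cochains
        intro!: image_eqI[of _ _ "cup X (alternate b) c"])
  have "coboundary X (cup X c b) = cup X a b"
    using b c by (auto simp: coboundary_cup cocycle_ring_simps)
  then show "a \<otimes>\<^bsub>cocycle_ring R X\<^esub> b \<in> coboundaries R X"
    using b c by (auto simp: coboundaries_def cocycle_ring_simps cup_in_cochains
        intro!: image_eqI[of _ _ "cup X c b"])
qed

lemma ring_cohomology_ring: "ring (cohomology_ring R X)"
  unfolding cohomology_ring_def by (rule ideal.quotient_is_ring[OF ideal_coboundaries])

definition cohomology_class ::
    "'r::{comm_ring, comm_monoid_mult} itself \<Rightarrow> 'a topology \<Rightarrow> ('a, 'r) cochain \<Rightarrow>
     ('a, 'r) cochain set" where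
  "cohomology_class R X a = coboundaries R X +>\<^bsub>cocycle_ring R X\<^esub> a"

lemma cohomology_class_hom: "cohomology_class R X \<in> ring_hom (cocycle_ring R X) (cohomology_ring R X)"
  unfolding cohomology_class_def[abs_def] cohomology_ring_def
  by (rule ideal.rcos_ring_hom[OF ideal_coboundaries])

lemma cohomology_class_ring_hom_ring:
  "ring_hom_ring (cocycle_ring R X) (cohomology_ring R X) (cohomology_class R X)"
  by (intro ring_hom_ringI2 ring_cocycle_ring ring_cohomology_ring cohomology_class_hom)

lemma carrier_cohomology_ring:
  "carrier (cohomology_ring R X) = cohomology_class R X ` carrier (cocycle_ring R X)"
  by (auto simp: cohomology_ring_def FactRing_def A_RCOSETS_def' cohomology_class_def)

lemma cohomology_class_eq_iff:
  assumes "a \<in> carrier (cocycle_ring R X)" "b \<in> carrier (cocycle_ring R X)"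
  shows "cohomology_class R X a = cohomology_class R X b \<longleftrightarrow> (\<lambda>n \<sigma>. a n \<sigma> - b n \<sigma>) \<in> coboundaries R X"
  using ring.quotient_eq_iff_same_a_r_cos[OF ring_cocycle_ring ideal_coboundaries assms]
  by (simp add: cohomology_class_def a_minus_cocycle_ring assms)

lemma cohomology_class_eq_zero_iff:
  assumes "a \<in> carrier (cocycle_ring R X)"
  shows "cohomology_class R X a = \<zero>\<^bsub>cohomology_ring R X\<^esub> \<longleftrightarrow> a \<in> coboundaries R X"
proof -
  interpret ring_hom_ring "cocycle_ring R X" "cohomology_ring R X" "cohomology_class R X"
    by (rule cohomology_class_ring_hom_ring)
  have "\<zero>\<^bsub>cohomology_ring R X\<^esub> = cohomology_class R X (\<lambda>n \<sigma>. 0)"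
    using hom_zero by (simp add: cocycle_ring_simps)
  moreover have "(\<lambda>n \<sigma>. 0) \<in> carrier (cocycle_ring R X)"
    by (simp add: cocycle_ring_simps)
  ultimately show ?thesis
    using cohomology_class_eq_iff[OF assms] by simp
qed

lemma simplex_map_singular_face:
  assumes "1 \<le> n" "k \<le> n"
  shows "singular_face n k (simplex_map n f \<sigma>) = simplex_map (n - 1) f (singular_face n k \<sigma>)"
  using assms by (simp add: singular_face_simplex_map) (simp add: simplex_map_def singular_face_def
      cong: restrict_cong)

lemma cochain_pullback_coboundary:
  assumes "continuous_map X Y f"
  shows "cochain_pullback X f (coboundary Y c) = coboundary X (cochain_pullback X f c)"
proof (intro ext)
  fix n \<sigma>
  show "cochain_pullback X f (coboundary Y c) n \<sigma> = coboundary X (cochain_pullback X f c) n \<sigma>"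
  proof (cases "n \<noteq> 0 \<and> singular_simplex n X \<sigma>")
    case True
    then have "singular_simplex (n - 1) X (singular_face n k \<sigma>)" if "k \<le> n" for k
      using singular_simplex_singular_face[of n X \<sigma> k] that by simp
    with True assms show ?thesis
      by (auto simp: cochain_pullback_def coboundary_def singular_simplex_simplex_map
          simplex_map_singular_face intro!: sum.cong)
  qed (auto simp: cochain_pullback_def coboundary_def)
qed

lemma cochain_pullback_cup:
  assumes "continuous_map X Y f"
  shows "cochain_pullback X f (cup Y a b) = cup X (cochain_pullback X f a) (cochain_pullback X f b)"
  using assms
  by (auto simp: fun_eq_iff cochain_pullback_def cup_def singular_simplex_simplex_map
      singular_simplex_front_face singular_simplex_back_face front_face_simplex_map
      back_face_simplex_map intro!: sum.cong)

lemma cochain_pullback_add: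
  "cochain_pullback X f (\<lambda>n \<sigma>. a n \<sigma> + b n \<sigma>) =
    (\<lambda>n \<sigma>. cochain_pullback X f a n \<sigma> + cochain_pullback X f b n \<sigma>)"
  by (auto simp: cochain_pullback_def fun_eq_iff)

lemma cochain_pullback_zero [simp]: "cochain_pullback X f (\<lambda>n \<sigma>. 0) = (\<lambda>n \<sigma>. 0)"
  by (auto simp: cochain_pullback_def fun_eq_iff)

lemma cochain_pullback_unit:
  "continuous_map X Y f \<Longrightarrow> cochain_pullback X f (unit_cochain Y) = unit_cochain X"
  by (auto simp: cochain_pullback_def unit_cochain_def fun_eq_iff singular_simplex_simplex_map)

lemma cochain_pullback_in_cochains:
  assumes "c \<in> cochains R Y"
  shows "cochain_pullback X f c \<in> cochains R X"
proof -
  have "{n. cochain_pullback X f c n \<noteq> (\<lambda>\<sigma>. 0)} \<subseteq> {n. c n \<noteq> (\<lambda>\<sigma>. 0)}"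
    by (auto simp: cochain_pullback_def fun_eq_iff)
  with assms show ?thesis
    by (auto simp: cochains_def cochain_pullback_def intro: finite_subset)
qed

lemma cochain_pullback_in_cocycles:
  assumes "continuous_map X Y f" "c \<in> carrier (cocycle_ring R Y)"
  shows "cochain_pullback X f c \<in> carrier (cocycle_ring R X)"
  using assms cochain_pullback_coboundary[OF assms(1), of c]
  by (auto simp: cocycle_ring_simps intro: cochain_pullback_in_cochains)

lemma cochain_pullback_compose:
  assumes "continuous_map X Y f"
  shows "cochain_pullback X f (cochain_pullback Y g c) = cochain_pullback X (g \<circ> f) c"
proof (intro ext)
  fix n \<sigma>
  have "simplex_map n g (simplex_map n f \<sigma>) = simplex_map n (g \<circ> f) \<sigma>"
    using simplex_map_compose[of n g f] by (metis comp_apply)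
  then show "cochain_pullback X f (cochain_pullback Y g c) n \<sigma> = cochain_pullback X (g \<circ> f) c n \<sigma>"
    using singular_simplex_simplex_map[OF _ assms, of n \<sigma>]
    by (simp add: cochain_pullback_def)
qed

text \<open>
The definition of \<open>cohomology_map\<close> takes a union over all representatives; they contribute the same
coset because pullback commutes with coboundaries.
\<close>

lemma cohomology_map_class:
  assumes f: "continuous_map X Y f" and c: "c \<in> carrier (cocycle_ring R Y)"
  shows "cohomology_map R X f (cohomology_class R Y c) = cohomology_class R X (cochain_pullback X f c)"
proof -
  interpret Y: ideal "coboundaries R Y" "cocycle_ring R Y" by (rule ideal_coboundaries)
  have "c \<in> cohomology_class R Y c"
    unfolding cohomology_class_def by (rule Y.a_rcos_self[OF c])
  then have "cohomology_class R Y c \<noteq> {}" by blast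
  moreover have "cohomology_class R X (cochain_pullback X f d) = cohomology_class R X (cochain_pullback X f c)"
    if d: "d \<in> cohomology_class R Y c" for d
  proof -
    obtain e where e: "e \<in> cochains R Y" "d = (\<lambda>n \<sigma>. coboundary Y e n \<sigma> + c n \<sigma>)"
      using d by (auto simp: cohomology_class_def a_r_coset_def' coboundaries_def cocycle_ring_simps)
    have "d \<in> carrier (cocycle_ring R Y)"
      using e c by (auto simp: cocycle_ring_simps coboundary_add add_in_cochains
          coboundary_in_cochains coboundary_coboundary)
    moreover have "(\<lambda>n \<sigma>. cochain_pullback X f d n \<sigma> - cochain_pullback X f c n \<sigma>) =
        coboundary X (cochain_pullback X f e)"
      using f by (simp add: e cochain_pullback_add cochain_pullback_coboundary)
    ultimately show ?thesis
      using e(1) c f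
      by (simp add: cohomology_class_eq_iff cochain_pullback_in_cocycles coboundaries_def
          cochain_pullback_in_cochains)
  qed
  ultimately have "(\<Union>d\<in>cohomology_class R Y c. cohomology_class R X (cochain_pullback X f d)) =
      cohomology_class R X (cochain_pullback X f c)"
    by (rule SUP_eq_const)
  then show ?thesis
    by (simp add: cohomology_map_def cohomology_class_def)
qed

lemma cohomology_map_closed:
  assumes "continuous_map X Y f" "z \<in> carrier (cohomology_ring R Y)"
  shows "cohomology_map R X f z \<in> carrier (cohomology_ring R X)"
  using assms by (auto simp: carrier_cohomology_ring cohomology_map_class cochain_pullback_in_cocycles)

lemma cohomology_map_ring_hom:
  assumes f: "continuous_map X Y f"
  shows "cohomology_map R X f \<in> ring_hom (cohomology_ring R Y) (cohomology_ring R X)"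
proof (rule ring_hom_memI)
  interpret X: ring_hom_ring "cocycle_ring R X" "cohomology_ring R X" "cohomology_class R X"
    by (rule cohomology_class_ring_hom_ring)
  interpret Y: ring_hom_ring "cocycle_ring R Y" "cohomology_ring R Y" "cohomology_class R Y"
    by (rule cohomology_class_ring_hom_ring)
  note map_class = cohomology_map_class[OF f, where R = R]
  note pullback = cochain_pullback_in_cocycles[OF f, where R = R]
  show "cohomology_map R X f z \<in> carrier (cohomology_ring R X)"
    if "z \<in> carrier (cohomology_ring R Y)" for z
    using f that by (rule cohomology_map_closed)
  fix z w assume "z \<in> carrier (cohomology_ring R Y)" "w \<in> carrier (cohomology_ring R Y)"
  then obtain a b where a: "a \<in> carrier (cocycle_ring R Y)" "z = cohomology_class R Y a"
    and b: "b \<in> carrier (cocycle_ring R Y)" "w = cohomology_class R Y b"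
    by (auto simp: carrier_cohomology_ring)
  have "cohomology_map R X f (z \<otimes>\<^bsub>cohomology_ring R Y\<^esub> w) =
      cohomology_class R X (cochain_pullback X f (a \<otimes>\<^bsub>cocycle_ring R Y\<^esub> b))"
    using a b map_class[of "a \<otimes>\<^bsub>cocycle_ring R Y\<^esub> b"] by simp
  also have "\<dots> = cohomology_class R X
      (cochain_pullback X f a \<otimes>\<^bsub>cocycle_ring R X\<^esub> cochain_pullback X f b)"
    using f by (simp add: cocycle_ring_simps cochain_pullback_cup)
  finally show "cohomology_map R X f (z \<otimes>\<^bsub>cohomology_ring R Y\<^esub> w) =
      cohomology_map R X f z \<otimes>\<^bsub>cohomology_ring R X\<^esub> cohomology_map R X f w"
    using a b by (simp add: map_class pullback)
  have "cohomology_map R X f (z \<oplus>\<^bsub>cohomology_ring R Y\<^esub> w) =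
      cohomology_class R X (cochain_pullback X f (a \<oplus>\<^bsub>cocycle_ring R Y\<^esub> b))"
    using a b map_class[of "a \<oplus>\<^bsub>cocycle_ring R Y\<^esub> b"] by simp
  also have "\<dots> = cohomology_class R X
      (cochain_pullback X f a \<oplus>\<^bsub>cocycle_ring R X\<^esub> cochain_pullback X f b)"
    by (simp add: cocycle_ring_simps cochain_pullback_add)
  finally show "cohomology_map R X f (z \<oplus>\<^bsub>cohomology_ring R Y\<^esub> w) =
      cohomology_map R X f z \<oplus>\<^bsub>cohomology_ring R X\<^esub> cohomology_map R X f w"
    using a b by (simp add: map_class pullback)
next
  interpret X: ring_hom_ring "cocycle_ring R X" "cohomology_ring R X" "cohomology_class R X"
    by (rule cohomology_class_ring_hom_ring)
  interpret Y: ring_hom_ring "cocycle_ring R Y" "cohomology_ring R Y" "cohomology_class R Y"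
    by (rule cohomology_class_ring_hom_ring)
  have "cohomology_map R X f (cohomology_class R Y \<one>\<^bsub>cocycle_ring R Y\<^esub>) =
      cohomology_class R X \<one>\<^bsub>cocycle_ring R X\<^esub>"
    using cohomology_map_class[OF f Y.R.one_closed]
    by (simp only: cocycle_ring_simps(3) cochain_pullback_unit[OF f])
  then show "cohomology_map R X f \<one>\<^bsub>cohomology_ring R Y\<^esub> = \<one>\<^bsub>cohomology_ring R X\<^esub>"
    by simp
qed

lemma cohomology_map_ring_hom_ring:
  "continuous_map X Y f \<Longrightarrow>
    ring_hom_ring (cohomology_ring R Y) (cohomology_ring R X) (cohomology_map R X f)"
  by (intro ring_hom_ringI2 ring_cohomology_ring cohomology_map_ring_hom)

lemma cohomology_map_compose:
  assumes "continuous_map X Y f" "continuous_map Y Z g" "z \<in> carrier (cohomology_ring R Z)"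
  shows "cohomology_map R X f (cohomology_map R Y g z) = cohomology_map R X (g \<circ> f) z"
  using assms continuous_map_compose[OF assms(1,2)]
  by (auto simp: carrier_cohomology_ring cohomology_map_class cochain_pullback_in_cocycles
      cochain_pullback_compose)

lemma ring_product_hom:
  assumes "ring_hom_ring H K \<phi>" "set zs \<subseteq> carrier H"
  shows "\<phi> (ring_product H zs) = ring_product K (map \<phi> zs)"
proof -
  interpret ring_hom_ring H K \<phi> by (rule assms)
  have "ring_product H zs \<in> carrier H \<and> \<phi> (ring_product H zs) = ring_product K (map \<phi> zs)"
    using assms(2) by (induction zs) (auto simp: ring_product_def)
  then show ?thesis ..
qed


section \<open>Homotopy invariance of cohomology\<close>

lemma chain_eval_boundary_cocycle:
  assumes "a \<in> carrier (cocycle_ring R Y)" "singular_chain (Suc n) Y w"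
  shows "chain_eval (a n) (chain_boundary (Suc n) w) = 0"
  using chain_eval_coboundary[OF assms(2), of a] assms(1) by (simp add: cocycle_ring_simps)

text \<open>
The transpose of a chain homotopy \<open>D\<close>: a cocycle \<open>a\<close> vanishes on boundaries, so a cochain of the form
\<open>a \<circ> (\<partial>D + D\<partial>)\<close> equals \<open>a \<circ> D \<circ> \<partial>\<close>, which is the coboundary of \<open>a \<circ> D\<close>.  It is applied to the prism operator
and to the contraction onto small simplices.
\<close>

lemma coboundary_if_chain_homotopic_to_zero:
  fixes a :: "('b, 'r::{comm_ring, comm_monoid_mult}) cochain"
    and D :: "nat \<Rightarrow> 'a chain \<Rightarrow> 'b chain"
  assumes a: "a \<in> carrier (cocycle_ring R Y)"
    and D_diff: "\<And>n z w. D n (z - w) = D n z - D n w"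
    and D_chain: "\<And>n z. singular_chain n X z \<Longrightarrow> singular_chain (Suc n) Y (D n z)"
    and c: "\<And>n \<sigma>. singular_simplex n X \<sigma> \<Longrightarrow> c n \<sigma> = chain_eval (a n)
        (chain_boundary (Suc n) (D n (frag_of \<sigma>)) + D (n - 1) (chain_boundary n (frag_of \<sigma>)))"
    and c_0: "\<And>n \<sigma>. \<not> singular_simplex n X \<sigma> \<Longrightarrow> c n \<sigma> = 0"
  shows "c \<in> coboundaries R X"
proof -
  define b where "b = (\<lambda>n \<sigma>. if singular_simplex n X \<sigma> then chain_eval (a (Suc n)) (D n (frag_of \<sigma>)) else 0)"
  have D_0: "D n 0 = 0" for n
    using D_diff[of n 0 0] by simp
  have eval_b: "chain_eval (b n) z = chain_eval (a (Suc n)) (D n z)" if "singular_chain n X z" for n z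
    using that unfolding singular_chain_def
    by (induction z rule: frag_induction) (auto simp: D_0 D_diff chain_eval_diff b_def)
  have "Suc -` {n. a n \<noteq> (\<lambda>\<sigma>. 0)} \<supseteq> {n. b n \<noteq> (\<lambda>\<sigma>. 0)}"
    by (auto simp: b_def)
  moreover have "finite (Suc -` {n. a n \<noteq> (\<lambda>\<sigma>. 0)})"
    using a by (intro finite_vimageI) (auto simp: cocycle_ring_simps cochains_def)
  ultimately have "finite {n. b n \<noteq> (\<lambda>\<sigma>. 0)}"
    by (rule finite_subset)
  then have "b \<in> cochains R X"
    by (auto simp: cochains_def b_def)
  moreover have "coboundary X b = c"
  proof (intro ext)
    fix n \<sigma>
    show "coboundary X b n \<sigma> = c n \<sigma>"
    proof (cases "singular_simplex n X \<sigma>")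
      case True
      then have \<sigma>: "singular_chain n X (frag_of \<sigma>)"
        by (simp add: singular_chain_of)
      have "chain_eval (b (n - 1)) (chain_boundary n (frag_of \<sigma>)) =
          chain_eval (a n) (D (n - 1) (chain_boundary n (frag_of \<sigma>)))"
      proof (cases n)
        case 0
        then show ?thesis by (simp add: chain_boundary_def D_0)
      next
        case (Suc m)
        then show ?thesis
          using eval_b singular_chain_boundary[OF \<sigma>] by simp
      qed
      then show ?thesis
        using True c[OF True] chain_eval_boundary_cocycle[OF a D_chain[OF \<sigma>]]
        by (simp add: coboundary_eq_chain_eval chain_eval_add)
    next
      case False
      then show ?thesis
        by (simp add: coboundary_def c_0)
    qed
  qed
  ultimately show ?thesis
    unfolding coboundaries_def by blast
qed

text \<open>
The identity and a constant map induce homologous cycles, and a cycle of positive degree in a point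
is a boundary.
\<close>

lemma contractible_space_cycle_bounds:
  assumes "contractible_space X" "1 \<le> p" and z: "singular_chain p X z" "chain_boundary p z = 0"
  obtains w where "singular_chain (Suc p) X w" "chain_boundary (Suc p) w = z"
proof (cases "topspace X = {}")
  case True
  then have "z = 0"
    using z(1) singular_chain_empty by blast
  then show ?thesis
    using that[of 0] by simp
next
  case False
  obtain a where a: "homotopic_with (\<lambda>x. True) X X id (\<lambda>x. a)"
    using assms(1) unfolding contractible_space_def by blast
  then have cont: "continuous_map X X (\<lambda>x. a)"
    using homotopic_with_imp_continuous_maps by blast
  then have aX: "a \<in> topspace X"
    using False by (simp add: continuous_map_const)
  have cycle: "singular_relcycle p X {} z"
    by (simp add: singular_cycle z)
  have "homotopic_with (\<lambda>h. h \<in> {} \<rightarrow> {}) X X id (\<lambda>x. a)"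
    using a by simp
  then have "homologous_rel p X {} (chain_map p id z) (chain_map p (\<lambda>x. a) z)"
    by (rule homotopic_imp_homologous_rel_chain_maps[OF _ cycle])
  then obtain u where u: "singular_chain (Suc p) X u"
      "chain_boundary (Suc p) u = z - chain_map p (\<lambda>x. a) z"
    using chain_map_ident[OF z(1)] by (auto simp: homologous_rel_def singular_boundary)
  have "continuous_map X (subtopology X {a}) (\<lambda>x. a)"
    using aX by (simp add: continuous_map_const)
  then have "singular_relcycle p (subtopology X {a}) {} (chain_map p (\<lambda>x. a) z)"
    using z by (auto simp: singular_cycle singular_chain_chain_map chain_boundary_chain_map)
  then have "singular_relboundary p (subtopology X {a}) {} (chain_map p (\<lambda>x. a) z)"
    using aX assms(2) by (subst singular_boundary_eq_cycle_singleton[of _ a]) auto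
  then obtain v where v: "singular_chain (Suc p) (subtopology X {a}) v"
      "chain_boundary (Suc p) v = chain_map p (\<lambda>x. a) z"
    by (auto simp: singular_boundary)
  show ?thesis
  proof
    show "singular_chain (Suc p) X (u + v)"
      using u v by (simp add: singular_chain_add singular_chain_subtopology)
    show "chain_boundary (Suc p) (u + v) = z"
      using u v by (simp add: chain_boundary_add)
  qed
qed

abbreviation simplex_top :: "nat \<Rightarrow> (nat \<Rightarrow> real) topology" where
  "simplex_top p \<equiv> subtopology (powertop_real UNIV) (standard_simplex p)"

abbreviation cylinder :: "'a topology \<Rightarrow> (real \<times> 'a) topology" where
  "cylinder X \<equiv> prod_topology (top_of_set {0..1}) X"

lemma contractible_space_standard_simplex: "contractible_space (simplex_top p)"
proof -
  define a :: "nat \<Rightarrow> real" where "a = (\<lambda>j. if j = 0 then 1 else 0)"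
  have a: "a \<in> standard_simplex p" by (simp add: a_def)
  define h where "h = (\<lambda>(t :: real, x :: nat \<Rightarrow> real) i. (1 - t) * x i + t * a i)"
  have proj: "continuous_map (cylinder (simplex_top p)) euclideanreal (\<lambda>y. snd y i)" for i
  proof -
    have "continuous_map (simplex_top p) euclideanreal (\<lambda>x. x i)"
      by (auto intro: continuous_map_from_subtopology continuous_map_product_projection)
    then show ?thesis
      using continuous_map_compose[OF continuous_map_snd, of "simplex_top p" euclideanreal "\<lambda>x. x i" "top_of_set {0..1}"]
      by (simp add: comp_def)
  qed
  have proj0: "continuous_map (cylinder (simplex_top p)) euclideanreal fst"
    using continuous_map_fst continuous_map_into_fulltopology by blast
  have "continuous_map (cylinder (simplex_top p)) (powertop_real UNIV) h"
    unfolding continuous_map_componentwise h_def case_prod_unfold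
    by (auto intro!: continuous_intros proj proj0)
  moreover have "h (t, x) \<in> standard_simplex p" if "t \<in> {0..1}" "x \<in> standard_simplex p" for t x
    unfolding h_def using convex_standard_simplex[OF that(2) a, of t] that(1) by simp
  ultimately have "continuous_map (cylinder (simplex_top p)) (simplex_top p) h"
    by (auto simp: continuous_map_in_subtopology)
  moreover have "h (0, x) = id x" "h (1, x) = a" for x
    by (auto simp: h_def)
  ultimately have "homotopic_with (\<lambda>x. True) (simplex_top p) (simplex_top p) id (\<lambda>x. a)"
    unfolding homotopic_with_def by auto
  then show ?thesis
    unfolding contractible_space_def by blast
qed

lemma contractible_space_cylinder: "contractible_space X \<Longrightarrow> contractible_space (cylinder X)"
  by (simp add: contractible_space_prod_topology convex_imp_contractible)

text \<open>
For a chain \<open>c\<close> in \<open>[0, 1] \<times> \<Delta>\<^sup>p\<close>, a simplex \<open>\<sigma>\<close> is sent to the image of \<open>c\<close> under \<open>id \<times> \<sigma>\<close>.  This is the form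
of every operator that is natural in the space.
\<close>

definition prism_map :: "nat \<Rightarrow> (real \<times> (nat \<Rightarrow> real)) chain \<Rightarrow> 'a chain \<Rightarrow> (real \<times> 'a) chain" where
  "prism_map p c = frag_extend (\<lambda>\<sigma>. chain_map (Suc p) (map_prod id \<sigma>) c)"

lemma prism_map_diff: "prism_map p c (z - w) = prism_map p c z - prism_map p c w"
  by (simp add: prism_map_def frag_extend_diff)

lemma prism_map_of: "prism_map p c (frag_of \<sigma>) = chain_map (Suc p) (map_prod id \<sigma>) c"
  by (simp add: prism_map_def)

lemma prism_map_0 [simp]: "prism_map p c 0 = 0"
  by (simp add: prism_map_def)

lemma continuous_map_cylinder:
  "continuous_map X Y f \<Longrightarrow> continuous_map (cylinder X) (cylinder Y) (map_prod id f)"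
proof -
  assume f: "continuous_map X Y f"
  have "fst \<circ> map_prod id f = fst" "snd \<circ> map_prod id f = f \<circ> snd"
    by auto
  then show ?thesis
    using f by (auto simp: continuous_map_pairwise intro: continuous_map_fst
        continuous_map_compose[OF continuous_map_snd])
qed

lemma singular_chain_prism_map:
  assumes c: "singular_chain (Suc p) (cylinder (simplex_top p)) c" and z: "singular_chain p X z"
  shows "singular_chain (Suc p) (cylinder X) (prism_map p c z)"
  using z unfolding singular_chain_def[of p]
proof (induction z rule: frag_induction)
  case (one \<sigma>)
  then have "continuous_map (simplex_top p) X \<sigma>"
    by (simp add: singular_simplex_def)
  then show ?case
    unfolding prism_map_of using c continuous_map_cylinder singular_chain_chain_map by blast
qed (auto simp: prism_map_diff singular_chain_diff)

lemma prism_map_chain_map: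
  assumes c: "singular_chain (Suc p) (cylinder (simplex_top p)) c" and z: "singular_chain p X z"
  shows "prism_map p c (chain_map p g z) = chain_map (Suc p) (map_prod id g) (prism_map p c z)"
  using z unfolding singular_chain_def[of p]
proof (induction z rule: frag_induction)
  case (one \<sigma>)
  have "chain_map (Suc p) (map_prod id (simplex_map p g \<sigma>)) c =
      chain_map (Suc p) (map_prod id g \<circ> map_prod id \<sigma>) c"
    by (rule chain_map_eq[OF c]) (auto simp: simplex_map_def)
  then show ?case
    by (simp only: chain_map_of prism_map_of chain_map_compose comp_apply)
qed (auto simp: prism_map_diff chain_map_diff)

definition cylinder_ends :: "nat \<Rightarrow> 'a chain \<Rightarrow> (real \<times> 'a) chain" where
  "cylinder_ends p z = chain_map p (Pair 1) z - chain_map p (Pair 0) z"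

lemma cylinder_ends_diff: "cylinder_ends p (z - w) = cylinder_ends p z - cylinder_ends p w"
  by (simp add: cylinder_ends_def chain_map_diff)

lemma continuous_map_Pair: "t \<in> {0..1} \<Longrightarrow> continuous_map X (cylinder X) (Pair t)"
  by (auto intro!: continuous_map_pairedI)

lemma singular_chain_cylinder_ends: "singular_chain p X z \<Longrightarrow> singular_chain p (cylinder X) (cylinder_ends p z)"
  unfolding cylinder_ends_def
  by (intro singular_chain_diff; erule singular_chain_chain_map; simp add: continuous_map_Pair)

lemma chain_boundary_cylinder_ends:
  "singular_chain p X z \<Longrightarrow> chain_boundary p (cylinder_ends p z) = cylinder_ends (p - 1) (chain_boundary p z)"
  by (simp add: cylinder_ends_def chain_boundary_diff chain_boundary_chain_map)

lemma chain_map_cylinder_ends: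
  assumes "singular_chain p X z"
  shows "chain_map p (map_prod id g) (cylinder_ends p z) = cylinder_ends p (chain_map p g z)"
proof -
  have "map_prod id g \<circ> Pair t = Pair t \<circ> g" for t :: real
    by auto
  then show ?thesis
    unfolding cylinder_ends_def chain_map_diff
    by (metis chain_map_compose comp_apply)
qed

abbreviation id_simplex :: "nat \<Rightarrow> (nat \<Rightarrow> real) chain" where
  "id_simplex p \<equiv> frag_of (restrict id (standard_simplex p))"

lemma singular_chain_id_simplex: "singular_chain p (simplex_top p) (id_simplex p)"
  unfolding singular_chain_of singular_simplex_def
  by (auto intro: continuous_map_eq[OF continuous_map_id])

text \<open>
\<open>c\<close> is a filling of the prism over the \<open>p\<close>-simplex: its boundary consists of the top, the bottom, and the
side walls, which are copies of the filling \<open>c'\<close> one degree lower.  In degree \<open>0\<close> there are no walls, and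
\<open>c'\<close> is arbitrary.
\<close>

definition prism_chain ::
    "nat \<Rightarrow> (real \<times> (nat \<Rightarrow> real)) chain \<Rightarrow> (real \<times> (nat \<Rightarrow> real)) chain \<Rightarrow> bool" where
  "prism_chain p c' c \<longleftrightarrow> singular_chain (Suc p) (cylinder (simplex_top p)) c \<and>
     (p \<noteq> 0 \<longrightarrow> singular_chain p (cylinder (simplex_top (p - 1))) c') \<and>
     chain_boundary (Suc p) c = cylinder_ends p (id_simplex p) - prism_map (p - 1) c' (chain_boundary p (id_simplex p))"

text \<open>
By naturality, the boundary formula for the identity simplex implies the formula for all chains.
\<close>

lemma chain_boundary_prism_map:
  assumes c: "prism_chain p c' c" and z: "singular_chain p X z"
  shows "chain_boundary (Suc p) (prism_map p c z) = cylinder_ends p z - prism_map (p - 1) c' (chain_boundary p z)"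
  using z unfolding singular_chain_def[of p]
proof (induction z rule: frag_induction)
  case (one \<sigma>)
  then have \<sigma>: "singular_simplex p X \<sigma>" by simp
  have "chain_map p (map_prod id \<sigma>) (prism_map (p - 1) c' (chain_boundary p (id_simplex p))) =
      prism_map (p - 1) c' (chain_boundary p (frag_of \<sigma>))"
  proof (cases p)
    case 0
    then show ?thesis by (simp add: chain_boundary_def)
  next
    case (Suc q)
    have "chain_map q \<sigma> (chain_boundary p (id_simplex p)) = chain_boundary p (frag_of \<sigma>)"
      using chain_boundary_chain_map[OF singular_chain_id_simplex[of p], of \<sigma>]
        singular_simplex_chain_map_id[OF \<sigma>] Suc by simp
    moreover have "singular_chain q (simplex_top p) (chain_boundary p (id_simplex p))"
      using singular_chain_boundary[OF singular_chain_id_simplex[of p]] Suc by simp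
    ultimately show ?thesis
      using prism_map_chain_map[of q c' "simplex_top p" "chain_boundary p (id_simplex p)" \<sigma>] c Suc
      by (simp add: prism_chain_def)
  qed
  moreover have "chain_boundary (Suc p) (prism_map p c (frag_of \<sigma>)) =
      chain_map p (map_prod id \<sigma>) (chain_boundary (Suc p) c)"
    unfolding prism_map_of using c chain_boundary_chain_map[of "Suc p" _ c]
    by (auto simp: prism_chain_def)
  moreover have "chain_map p (map_prod id \<sigma>) (cylinder_ends p (id_simplex p)) = cylinder_ends p (frag_of \<sigma>)"
    using chain_map_cylinder_ends[OF singular_chain_id_simplex] singular_simplex_chain_map_id[OF \<sigma>] by metis
  ultimately show ?case
    using c by (simp add: prism_chain_def chain_map_diff)
next
  case (diff z w)
  then show ?case
    by (simp add: prism_map_diff cylinder_ends_diff chain_boundary_diff)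
qed (auto simp: cylinder_ends_def)

text \<open>
In degree \<open>0\<close> the two ends are points joined by a path.  The filling comes from the homology theorem
for homotopic maps, applied to the path between the two inclusions.
\<close>

lemma prism_chain_0: "\<exists>c. prism_chain 0 c' c"
proof -
  have "homotopic_with (\<lambda>h. h \<in> {} \<rightarrow> {}) (simplex_top 0) (cylinder (simplex_top 0)) (Pair 1) (Pair 0)"
    unfolding homotopic_with_def
  proof (intro exI conjI)
    \<comment> \<open>The parameter is reversed because the homotopy runs from the top to the bottom.\<close>
    show "continuous_map (cylinder (simplex_top 0)) (cylinder (simplex_top 0)) (\<lambda>(t, x). (1 - t, x))"
    proof -
      have "continuous_map (cylinder (simplex_top 0)) euclideanreal fst"
        using continuous_map_fst continuous_map_into_fulltopology by blast
      then have "continuous_map (cylinder (simplex_top 0)) (top_of_set {0..1}) (\<lambda>y. 1 - fst y)"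
        by (auto simp: continuous_map_in_subtopology intro!: continuous_intros)
      then show ?thesis
        by (simp add: continuous_map_pairwise comp_def case_prod_unfold continuous_map_snd)
    qed
  qed auto
  moreover have "singular_relcycle 0 (simplex_top 0) {} (id_simplex 0)"
    by (simp add: singular_cycle singular_chain_id_simplex chain_boundary_def)
  ultimately have "homologous_rel 0 (cylinder (simplex_top 0)) {}
      (chain_map 0 (Pair 1) (id_simplex 0)) (chain_map 0 (Pair 0) (id_simplex 0))"
    by (rule homotopic_imp_homologous_rel_chain_maps)
  then show ?thesis
    by (auto simp: homologous_rel_def singular_boundary prism_chain_def cylinder_ends_def chain_boundary_def)
qed

text \<open>
Top minus bottom minus walls is a cycle, by the boundary formula one degree lower and \<open>\<partial>\<partial> = 0\<close>, and
the cylinder over a simplex is contractible.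
\<close>

lemma prism_chain_Suc:
  assumes c: "prism_chain p c' c"
  shows "\<exists>d. prism_chain (Suc p) c d"
proof -
  let ?\<iota> = "id_simplex (Suc p)" and ?M = "cylinder (simplex_top (Suc p))"
  let ?z = "cylinder_ends (Suc p) ?\<iota> - prism_map p c (chain_boundary (Suc p) ?\<iota>)"
  have \<iota>: "singular_chain (Suc p) (simplex_top (Suc p)) ?\<iota>"
    by (rule singular_chain_id_simplex)
  then have boundary_chain: "singular_chain p (simplex_top (Suc p)) (chain_boundary (Suc p) ?\<iota>)"
    by (rule singular_chain_boundary_alt)
  have c_chain: "singular_chain (Suc p) (cylinder (simplex_top p)) c"
    using c by (simp add: prism_chain_def)
  have "singular_chain (Suc p) ?M ?z"
    using \<iota> boundary_chain c_chain by (intro singular_chain_diff singular_chain_cylinder_ends singular_chain_prism_map)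
  moreover have "chain_boundary (Suc p) ?z = 0"
    using chain_boundary_cylinder_ends[OF \<iota>] chain_boundary_prism_map[OF c boundary_chain] chain_boundary_boundary[OF \<iota>]
    by (simp add: chain_boundary_diff)
  ultimately obtain d where "singular_chain (Suc (Suc p)) ?M d" "chain_boundary (Suc (Suc p)) d = ?z"
    using contractible_space_cycle_bounds[of ?M "Suc p" ?z] contractible_space_cylinder
      contractible_space_standard_simplex by auto
  then show ?thesis
    using c_chain by (auto simp: prism_chain_def)
qed

lemma prism_operator_exists:
  "\<exists>D :: nat \<Rightarrow> 'a chain \<Rightarrow> (real \<times> 'a) chain.
    (\<forall>n z w. D n (z - w) = D n z - D n w) \<and>
    (\<forall>n X z. singular_chain n X z \<longrightarrow> singular_chain (Suc n) (cylinder X) (D n z) \<and>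
      chain_boundary (Suc n) (D n z) + D (n - 1) (chain_boundary n z) = cylinder_ends n z)"
proof -
  have "\<exists>P. \<forall>n. (\<exists>c'. prism_chain n c' (P n)) \<and> prism_chain (Suc n) (P n) (P (Suc n))"
    by (rule dependent_nat_choice) (use prism_chain_0 prism_chain_Suc in blast)+
  then obtain P where P: "\<And>n. \<exists>c'. prism_chain n c' (P n)"
    "\<And>n. prism_chain (Suc n) (P n) (P (Suc n))" by blast
  show ?thesis
  proof (intro exI[of _ "\<lambda>n. prism_map n (P n)"] conjI allI impI)
    show "prism_map n (P n) (z - w) = prism_map n (P n) z - prism_map n (P n) w" for n and z w :: "'a chain"
      by (rule prism_map_diff)
    show "singular_chain (Suc n) (cylinder X) (prism_map n (P n) z)" if "singular_chain n X z"
      for n and X :: "'a topology" and z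
      using P(1)[of n] singular_chain_prism_map[OF _ that] by (auto simp: prism_chain_def)
    show "chain_boundary (Suc n) (prism_map n (P n) z) + prism_map (n - 1) (P (n - 1)) (chain_boundary n z) = cylinder_ends n z"
      if z: "singular_chain n X z" for n and X :: "'a topology" and z
    proof (cases n)
      case 0
      obtain c' where "prism_chain 0 c' (P 0)" using P(1) by blast
      then show ?thesis
        using chain_boundary_prism_map[of 0 c' "P 0" X z] z 0 by (simp add: chain_boundary_def[of 0])
    next
      case (Suc m)
      then show ?thesis
        using chain_boundary_prism_map[OF P(2) , of m X z] z by simp
    qed
  qed
qed

lemma cochain_pullback_homotopic:
  assumes hom: "homotopic_with (\<lambda>h. True) X Y f g" and a: "a \<in> carrier (cocycle_ring R Y)"
  shows "(\<lambda>n \<sigma>. cochain_pullback X g a n \<sigma> - cochain_pullback X f a n \<sigma>) \<in> coboundaries R X"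
proof -
  obtain h where h: "continuous_map (cylinder X) Y h" "\<And>x. h (0, x) = f x" "\<And>x. h (1, x) = g x"
    using hom unfolding homotopic_with_def by blast
  obtain D :: "nat \<Rightarrow> 'a chain \<Rightarrow> (real \<times> 'a) chain" where
    D: "\<And>n z w. D n (z - w) = D n z - D n w"
      "\<And>n X z. singular_chain n X z \<Longrightarrow> singular_chain (Suc n) (cylinder X) (D n z)"
      "\<And>n X z. singular_chain n X z \<Longrightarrow>
        chain_boundary (Suc n) (D n z) + D (n - 1) (chain_boundary n z) = cylinder_ends n z"
    using prism_operator_exists[where 'a = 'a] by blast
  have D_0: "D n 0 = 0" for n
    using D(1)[of n 0 0] by simp
  \<comment> \<open>The prism operator followed by the homotopy is a chain homotopy from \<open>f\<close> to \<open>g\<close>.\<close>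
  define K where "K = (\<lambda>n z. chain_map (Suc n) h (D n z))"
  show ?thesis
  proof (rule coboundary_if_chain_homotopic_to_zero[OF a, where D = K])
    show "K n (z - w) = K n z - K n w" for n z w
      by (simp add: K_def D chain_map_diff)
    show "singular_chain (Suc n) Y (K n z)" if "singular_chain n X z" for n z
      unfolding K_def using D(2)[OF that] h(1) by (rule singular_chain_chain_map)
  next
    fix n \<sigma> assume \<sigma>: "singular_simplex n X \<sigma>"
    then have z: "singular_chain n X (frag_of \<sigma>)"
      by (simp add: singular_chain_of)
    have "K (n - 1) (chain_boundary n (frag_of \<sigma>)) = chain_map n h (D (n - 1) (chain_boundary n (frag_of \<sigma>)))"
      by (cases n) (auto simp: K_def chain_boundary_def D_0)
    moreover have "chain_boundary (Suc n) (K n (frag_of \<sigma>)) = chain_map n h (chain_boundary (Suc n) (D n (frag_of \<sigma>)))"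
      unfolding K_def using chain_boundary_chain_map[OF D(2)[OF z]] by simp
    ultimately have "chain_boundary (Suc n) (K n (frag_of \<sigma>)) + K (n - 1) (chain_boundary n (frag_of \<sigma>)) =
        chain_map n h (cylinder_ends n (frag_of \<sigma>))"
      using D(3)[OF z] by (simp flip: chain_map_add)
    also have "\<dots> = chain_map n (h \<circ> Pair 1) (frag_of \<sigma>) - chain_map n (h \<circ> Pair 0) (frag_of \<sigma>)"
      by (simp only: cylinder_ends_def chain_map_diff chain_map_compose comp_apply)
    also have "\<dots> = chain_map n g (frag_of \<sigma>) - chain_map n f (frag_of \<sigma>)"
      using h by (simp add: comp_def)
    finally show "cochain_pullback X g a n \<sigma> - cochain_pullback X f a n \<sigma> = chain_eval (a n)
        (chain_boundary (Suc n) (K n (frag_of \<sigma>)) + K (n - 1) (chain_boundary n (frag_of \<sigma>)))"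
      using \<sigma> by (simp add: cochain_pullback_def chain_eval_diff)
  qed (simp add: cochain_pullback_def)
qed

lemma cohomology_map_homotopic:
  assumes hom: "homotopic_with (\<lambda>h. True) X Y f g" and z: "z \<in> carrier (cohomology_ring R Y)"
  shows "cohomology_map R X f z = cohomology_map R X g z"
proof -
  have "continuous_map X Y f" "continuous_map X Y g"
    using homotopic_with_imp_continuous_maps[OF hom] by auto
  moreover obtain a where "a \<in> carrier (cocycle_ring R Y)" "z = cohomology_class R Y a"
    using z by (auto simp: carrier_cohomology_ring)
  ultimately have "cohomology_class R X (cochain_pullback X g a) = cohomology_class R X (cochain_pullback X f a)"
    and "cohomology_map R X f z = cohomology_class R X (cochain_pullback X f a)"
    and "cohomology_map R X g z = cohomology_class R X (cochain_pullback X g a)"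
    using cochain_pullback_homotopic[OF hom, of a R]
    by (simp_all add: cohomology_class_eq_iff cochain_pullback_in_cocycles cohomology_map_class)
  then show ?thesis by simp
qed


section \<open>Cocycles that vanish on small simplices\<close>

definition small_chain :: "'a set set \<Rightarrow> nat \<Rightarrow> 'a topology \<Rightarrow> 'a chain \<Rightarrow> bool" where
  "small_chain \<C> n X z \<longleftrightarrow>
     (\<forall>\<sigma>\<in>Poly_Mapping.keys z. \<exists>V\<in>\<C>. singular_simplex n (subtopology X V) \<sigma>)"

lemma small_chain_diff: "small_chain \<C> n X z \<Longrightarrow> small_chain \<C> n X w \<Longrightarrow> small_chain \<C> n X (z - w)"
  unfolding small_chain_def using keys_diff[of z w] by blast

lemma small_chain_0 [simp]: "small_chain \<C> n X 0"
  by (simp add: small_chain_def)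

lemma small_chain_subtopology:
  "V \<in> \<C> \<Longrightarrow> singular_chain n (subtopology X V) z \<Longrightarrow> small_chain \<C> n X z"
  by (auto simp: small_chain_def singular_chain_def)

lemma small_chain_operator:
  assumes "\<And>z w. h (z - w) = h z - h w" "h 0 = 0"
    and "\<And>V z. singular_chain n (subtopology X V) z \<Longrightarrow> singular_chain m (subtopology X V) (h z)"
    and z: "small_chain \<C> n X z"
  shows "small_chain \<C> m X (h z)"
proof -
  have "Poly_Mapping.keys z \<subseteq> {\<sigma>. \<exists>V\<in>\<C>. singular_simplex n (subtopology X V) \<sigma>}"
    using z by (auto simp: small_chain_def)
  then show ?thesis
  proof (induction z rule: frag_induction)
    case (one \<sigma>)
    then obtain V where "V \<in> \<C>" "singular_simplex n (subtopology X V) \<sigma>" by blast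
    then show ?case
      using assms(3) small_chain_subtopology singular_chain_of by metis
  qed (auto simp: assms small_chain_diff)
qed

text \<open>
The complex of all chains modulo small chains is acyclic.  If \<open>h\<close> is the homotopy between the
identity and an iterated subdivision that makes \<open>z\<close> small, then \<open>z + \<partial>hz\<close> is that subdivision minus
\<open>h\<partial>z\<close>, and \<open>h\<close> preserves smallness because it acts inside each member of the cover.
\<close>

lemma relative_cycle_mod_small_bounds:
  assumes open_cover: "\<forall>V\<in>\<C>. openin X V" "topspace X \<subseteq> \<Union>\<C>"
    and z: "singular_chain p X z" and small: "small_chain \<C> (p - 1) X (chain_boundary p z)"
  obtains w where "singular_chain (Suc p) X w" "small_chain \<C> p X (z - chain_boundary (Suc p) w)"
proof -
  obtain n where n: "\<And>m \<sigma>. n \<le> m \<Longrightarrow> \<sigma> \<in> Poly_Mapping.keys ((singular_subdivision p ^^ m) z) \<Longrightarrow>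
      \<exists>V\<in>\<C>. \<sigma> \<in> standard_simplex p \<rightarrow> V"
    using sufficient_iterated_singular_subdivision_exists[of \<C> X p z] open_cover z by metis
  obtain h where h: "\<And>p. h p 0 = (0 :: 'a chain)" "\<And>p z w. h p (z - w) = h p z - h p w"
    "\<And>p X z. singular_chain p X z \<Longrightarrow> singular_chain (Suc p) X (h p z)"
    "\<And>p X z. singular_chain p X z \<Longrightarrow> chain_boundary (Suc p) (h p z) + h (p - Suc 0) (chain_boundary p z)
        = (singular_subdivision p ^^ n) z - z"
    using chain_homotopic_iterated_singular_subdivision[of n] by metis
  have "singular_chain p X ((singular_subdivision p ^^ n) z)"
    using z by (induction n) (auto simp: singular_chain_singular_subdivision)
  then have "\<exists>V\<in>\<C>. singular_simplex p (subtopology X V) \<sigma>"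
    if "\<sigma> \<in> Poly_Mapping.keys ((singular_subdivision p ^^ n) z)" for \<sigma>
    using n[OF order_refl that] that unfolding singular_chain_def singular_simplex_subtopology
    by (metis image_subset_iff_funcset mem_Collect_eq subsetD)
  then have "small_chain \<C> p X ((singular_subdivision p ^^ n) z)"
    by (simp add: small_chain_def)
  moreover have "small_chain \<C> p X (h (p - 1) (chain_boundary p z))"
  proof (cases p)
    case 0
    then show ?thesis by (simp add: chain_boundary_def h)
  next
    case (Suc q)
    then show ?thesis
      using small_chain_operator[of "h q" q X p \<C> "chain_boundary p z"] h small by simp
  qed
  ultimately have "small_chain \<C> p X ((singular_subdivision p ^^ n) z - h (p - 1) (chain_boundary p z))"
    by (rule small_chain_diff)
  moreover have "(singular_subdivision p ^^ n) z - h (p - 1) (chain_boundary p z) =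
      z - chain_boundary (Suc p) (- h p z)"
    using h(4)[OF z] by (simp add: chain_boundary_minus algebra_simps)
  ultimately show ?thesis
    using that[of "- h p z"] h(3)[OF z] by (simp add: singular_chain_minus)
qed

text \<open>
\<open>\<sigma> - \<partial>d\<sigma> - d'\<partial>\<sigma>\<close> is small for all \<open>p\<close>-simplices, i.e. \<open>d\<close> and \<open>d'\<close> are the components in degrees \<open>p\<close> and
\<open>p - 1\<close> of a contraction of the complex of chains modulo small chains.  The number of subdivisions
needed depends on \<open>\<sigma>\<close>, so a single iterated subdivision does not provide such a contraction.
\<close>

definition contraction_mod_small ::
    "'a set set \<Rightarrow> 'a topology \<Rightarrow> nat \<Rightarrow> (((nat \<Rightarrow> real) \<Rightarrow> 'a) \<Rightarrow> 'a chain) \<Rightarrow>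
     (((nat \<Rightarrow> real) \<Rightarrow> 'a) \<Rightarrow> 'a chain) \<Rightarrow> bool" where
  "contraction_mod_small \<C> X p d' d \<longleftrightarrow> (\<forall>\<sigma>. singular_simplex p X \<sigma> \<longrightarrow>
     singular_chain (Suc p) X (d \<sigma>) \<and>
     small_chain \<C> p X (frag_of \<sigma> - chain_boundary (Suc p) (d \<sigma>) -
       frag_extend d' (chain_boundary p (frag_of \<sigma>))))"

lemma contraction_mod_small_chain:
  assumes d: "contraction_mod_small \<C> X p d' d" and z: "singular_chain p X z"
  shows "singular_chain (Suc p) X (frag_extend d z)"
    and "small_chain \<C> p X (z - chain_boundary (Suc p) (frag_extend d z) - frag_extend d' (chain_boundary p z))"
proof -
  show "singular_chain (Suc p) X (frag_extend d z)"
    using d z by (intro singular_chain_extend) (auto simp: contraction_mod_small_def singular_chain_def)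
  show "small_chain \<C> p X (z - chain_boundary (Suc p) (frag_extend d z) - frag_extend d' (chain_boundary p z))"
    using z unfolding singular_chain_def
  proof (induction z rule: frag_induction)
    case (diff z w)
    let ?r = "\<lambda>z. z - chain_boundary (Suc p) (frag_extend d z) - frag_extend d' (chain_boundary p z)"
    have eq: "?r (z - w) = ?r z - ?r w"
      by (simp add: chain_boundary_diff frag_extend_diff)
    show ?case
      unfolding eq using diff by (rule small_chain_diff)
  qed (use d in \<open>auto simp: contraction_mod_small_def\<close>)
qed

lemma contraction_mod_small_0:
  assumes open_cover: "\<forall>V\<in>\<C>. openin X V" "topspace X \<subseteq> \<Union>\<C>"
  shows "\<exists>d. contraction_mod_small \<C> X 0 d' d"
proof -
  have "\<exists>w. singular_chain (Suc 0) X w \<and> small_chain \<C> 0 X (frag_of \<sigma> - chain_boundary (Suc 0) w)"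
    if "singular_simplex 0 X \<sigma>" for \<sigma>
    using relative_cycle_mod_small_bounds[OF open_cover, of 0 "frag_of \<sigma>"] that
    by (auto simp: singular_chain_of chain_boundary_def[of 0])
  then show ?thesis
    unfolding contraction_mod_small_def chain_boundary_def[of 0] by simp metis
qed

text \<open>
The usual construction of a contraction of an acyclic free complex: \<open>\<sigma> - d\<partial>\<sigma>\<close> is a cycle modulo small
chains, and the value at \<open>\<sigma>\<close> is a chain that bounds it.
\<close>

lemma contraction_mod_small_Suc:
  assumes open_cover: "\<forall>V\<in>\<C>. openin X V" "topspace X \<subseteq> \<Union>\<C>"
    and d: "contraction_mod_small \<C> X p d' d"
  shows "\<exists>e. contraction_mod_small \<C> X (Suc p) d e"
proof -
  have "\<exists>w. singular_chain (Suc (Suc p)) X w \<and> small_chain \<C> (Suc p) X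
      (frag_of \<sigma> - chain_boundary (Suc (Suc p)) w - frag_extend d (chain_boundary (Suc p) (frag_of \<sigma>)))"
    if "singular_simplex (Suc p) X \<sigma>" for \<sigma>
  proof -
    have \<sigma>: "singular_chain (Suc p) X (frag_of \<sigma>)"
      using that by (simp add: singular_chain_of)
    let ?b = "chain_boundary (Suc p) (frag_of \<sigma>)"
    note boundary_chain = singular_chain_boundary_alt[OF \<sigma>]
    have "singular_chain (Suc p) X (frag_of \<sigma> - frag_extend d ?b)"
      using \<sigma> contraction_mod_small_chain(1)[OF d boundary_chain] by (rule singular_chain_diff)
    moreover have "small_chain \<C> (Suc p - 1) X (chain_boundary (Suc p) (frag_of \<sigma> - frag_extend d ?b))"
      using contraction_mod_small_chain(2)[OF d boundary_chain] chain_boundary_boundary[OF \<sigma>]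
      by (simp add: chain_boundary_diff)
    ultimately obtain w where "singular_chain (Suc (Suc p)) X w"
      "small_chain \<C> (Suc p) X (frag_of \<sigma> - frag_extend d ?b - chain_boundary (Suc (Suc p)) w)"
      by (rule relative_cycle_mod_small_bounds[OF open_cover])
    then show ?thesis
      by (auto simp: algebra_simps)
  qed
  then show ?thesis
    unfolding contraction_mod_small_def by metis
qed

text \<open>
For the contraction \<open>D\<close>, the chain \<open>\<sigma> - (\<partial>D + D\<partial>)\<sigma>\<close> is small, hence \<open>a = a \<circ> (\<partial>D + D\<partial>)\<close>.
\<close>

lemma cocycle_vanishing_on_small_simplices:
  assumes open_cover: "\<forall>V\<in>\<C>. openin X V" "topspace X \<subseteq> \<Union>\<C>"
    and a: "a \<in> carrier (cocycle_ring R X)"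
    and vanish: "\<And>n \<sigma> V. V \<in> \<C> \<Longrightarrow> singular_simplex n (subtopology X V) \<sigma> \<Longrightarrow> a n \<sigma> = 0"
  shows "a \<in> coboundaries R X"
proof -
  have "\<exists>d. \<forall>n. (\<exists>d'. contraction_mod_small \<C> X n d' (d n)) \<and> contraction_mod_small \<C> X (Suc n) (d n) (d (Suc n))"
    by (rule dependent_nat_choice)
      (use contraction_mod_small_0[OF open_cover] contraction_mod_small_Suc[OF open_cover] in blast)+
  then obtain d where d: "\<And>n. \<exists>d'. contraction_mod_small \<C> X n d' (d n)"
    "\<And>n. contraction_mod_small \<C> X (Suc n) (d n) (d (Suc n))" by blast
  show ?thesis
  proof (rule coboundary_if_chain_homotopic_to_zero[OF a, where D = "\<lambda>n. frag_extend (d n)"])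
    show "singular_chain (Suc n) X (frag_extend (d n) z)" if "singular_chain n X z" for n z
      using d(1) contraction_mod_small_chain(1)[OF _ that] by blast
  next
    fix n \<sigma> assume "singular_simplex n X \<sigma>"
    then have \<sigma>: "singular_chain n X (frag_of \<sigma>)"
      by (simp add: singular_chain_of)
    let ?w = "chain_boundary (Suc n) (frag_extend (d n) (frag_of \<sigma>)) +
        frag_extend (d (n - 1)) (chain_boundary n (frag_of \<sigma>))"
    have "small_chain \<C> n X (frag_of \<sigma> - ?w)"
    proof (cases n)
      case 0
      obtain d' where "contraction_mod_small \<C> X 0 d' (d 0)" using d(1) by blast
      from contraction_mod_small_chain(2)[OF this \<sigma>[unfolded 0]] 0 show ?thesis
        by (simp add: chain_boundary_def[of 0])
    next
      case (Suc m)
      then show ?thesis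
        using contraction_mod_small_chain(2)[OF d(2)[of m] \<sigma>[unfolded Suc]] by (simp add: diff_diff_eq)
    qed
    then have "chain_eval (a n) (frag_of \<sigma> - ?w) = 0"
      by (intro chain_eval_eq_0) (auto simp: small_chain_def vanish)
    then show "a n \<sigma> = chain_eval (a n) ?w"
      by (simp add: chain_eval_diff)
  next
    show "a n \<sigma> = 0" if "\<not> singular_simplex n X \<sigma>" for n \<sigma>
      using a that by (simp add: cocycle_ring_simps cochains_def)
  qed (rule frag_extend_diff)
qed


section \<open>Products of locally vanishing classes\<close>

definition vanishes_on :: "'a topology \<Rightarrow> ('a, 'r::{comm_ring, comm_monoid_mult}) cochain \<Rightarrow> 'a set \<Rightarrow> bool" where
  "vanishes_on X a W \<longleftrightarrow> (\<forall>n \<sigma>. singular_simplex n (subtopology X W) \<sigma> \<longrightarrow> a n \<sigma> = 0)"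

text \<open>
The faces of a simplex inside \<open>W\<close> stay inside \<open>W\<close>.
\<close>

lemma vanishes_on_cup:
  assumes "vanishes_on X a W \<or> vanishes_on X b W"
  shows "vanishes_on X (cup X a b) W"
  unfolding vanishes_on_def
proof (intro allI impI)
  fix n \<sigma> assume "singular_simplex n (subtopology X W) \<sigma>"
  then have "a p (front_face p \<sigma>) * b (n - p) (back_face n p \<sigma>) = 0" if "p \<le> n" for p
    using assms singular_simplex_front_face singular_simplex_back_face that
    unfolding vanishes_on_def by (metis mult_zero_left mult_zero_right)
  then show "cup X a b n \<sigma> = 0"
    by (simp add: cup_def)
qed

lemma vanishes_on_ring_product:
  assumes "c \<in> set cs" "vanishes_on X c W"
  shows "vanishes_on X (ring_product (cocycle_ring R X) cs) W"
  using assms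
  by (induction cs) (auto simp: ring_product_def cocycle_ring_simps(2) vanishes_on_cup)

text \<open>
If the restriction of a cocycle \<open>c\<close> to \<open>W\<close> is the coboundary of \<open>b\<close>, extend \<open>b\<close> by zero to the simplices that
leave \<open>W\<close> and subtract its coboundary from \<open>c\<close>.
\<close>

lemma vanishing_representative:
  assumes z: "z \<in> carrier (cohomology_ring R X)"
    and zero: "cohomology_map R (subtopology X W) id z = \<zero>\<^bsub>cohomology_ring R (subtopology X W)\<^esub>"
  shows "\<exists>a\<in>carrier (cocycle_ring R X). cohomology_class R X a = z \<and> vanishes_on X a W"
proof -
  let ?XW = "subtopology X W"
  have id: "continuous_map ?XW X id"
    by (simp add: continuous_map_from_subtopology)
  obtain c where c: "c \<in> carrier (cocycle_ring R X)" "z = cohomology_class R X c"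
    using z by (auto simp: carrier_cohomology_ring)
  have "cochain_pullback ?XW id c \<in> coboundaries R ?XW"
    using zero c id
    by (simp add: cohomology_map_class cohomology_class_eq_zero_iff cochain_pullback_in_cocycles)
  then obtain b where b: "b \<in> cochains R ?XW" "cochain_pullback ?XW id c = coboundary ?XW b"
    by (auto simp: coboundaries_def)
  \<comment> \<open>A cochain of the subspace is \<open>0\<close> outside its simplices, so it is its own extension by zero.\<close>
  have bX: "b \<in> cochains R X"
    using b(1) by (auto simp: cochains_def singular_simplex_subtopology)
  define a where "a = (\<lambda>n \<sigma>. c n \<sigma> - coboundary X b n \<sigma>)"
  have db: "coboundary X b \<in> carrier (cocycle_ring R X)" "coboundary X b \<in> coboundaries R X"
    using bX coboundaries_subset[of R X] by (auto simp: coboundaries_def)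
  interpret ring "cocycle_ring R X" by (rule ring_cocycle_ring)
  have a: "a \<in> carrier (cocycle_ring R X)"
    unfolding a_def using a_minus_cocycle_ring[OF c(1) db(1)] minus_closed[OF c(1) db(1)] by simp
  moreover have "cohomology_class R X a = z"
    using c a db(2) cohomology_class_eq_iff[OF c(1) a] by (simp add: a_def)
  moreover have "vanishes_on X a W"
    unfolding vanishes_on_def
  proof (intro allI impI)
    fix n \<sigma> assume \<sigma>: "singular_simplex n ?XW \<sigma>"
    then have "singular_simplex n X \<sigma>" "simplex_map n id \<sigma> = \<sigma>"
      by (auto simp: singular_simplex_def extensional_restrict dest: continuous_map_into_fulltopology)
    moreover have "cochain_pullback ?XW id c n \<sigma> = coboundary ?XW b n \<sigma>"
      by (simp add: b)
    ultimately show "a n \<sigma> = 0"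
      using \<sigma> by (simp add: a_def cochain_pullback_def coboundary_def)
  qed
  ultimately show ?thesis by blast
qed

theorem ring_product_zero_if_locally_zero:
  fixes W :: "nat \<Rightarrow> 'a set"
  assumes W: "\<And>i. i \<le> n \<Longrightarrow> openin X (W i)" "topspace X \<subseteq> (\<Union>i\<le>n. W i)"
    and zs: "set zs \<subseteq> carrier (cohomology_ring R X)" "n < length zs"
    and zero: "\<And>z i. z \<in> set zs \<Longrightarrow> i \<le> n \<Longrightarrow>
      cohomology_map R (subtopology X (W i)) id z = \<zero>\<^bsub>cohomology_ring R (subtopology X (W i))\<^esub>"
  shows "ring_product (cohomology_ring R X) zs = \<zero>\<^bsub>cohomology_ring R X\<^esub>"
proof -
  \<comment> \<open>The factor \<open>j \<le> n\<close> takes care of the member \<open>W j\<close>; the factors beyond \<open>n\<close> are represented arbitrarily.\<close>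
  have "\<exists>a. a \<in> carrier (cocycle_ring R X) \<and> cohomology_class R X a = zs ! j \<and>
      (j \<le> n \<longrightarrow> vanishes_on X a (W j))" if "j < length zs" for j
  proof (cases "j \<le> n")
    case True
    then show ?thesis
      using vanishing_representative[OF subsetD[OF zs(1) nth_mem[OF that]] zero[OF nth_mem[OF that]]]
      by auto
  next
    case False
    have "zs ! j \<in> carrier (cohomology_ring R X)"
      using zs(1) that by auto
    then show ?thesis
      using False by (auto simp: carrier_cohomology_ring)
  qed
  then obtain a where a: "\<And>j. j < length zs \<Longrightarrow> a j \<in> carrier (cocycle_ring R X)"
    "\<And>j. j < length zs \<Longrightarrow> cohomology_class R X (a j) = zs ! j"
    "\<And>j. j < length zs \<Longrightarrow> j \<le> n \<Longrightarrow> vanishes_on X (a j) (W j)"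
    by metis
  define cs where "cs = map a [0..<length zs]"
  let ?c = "ring_product (cocycle_ring R X) cs"
  have cs: "set cs \<subseteq> carrier (cocycle_ring R X)"
    using a(1) by (auto simp: cs_def)
  interpret ring "cocycle_ring R X" by (rule ring_cocycle_ring)
  have c: "?c \<in> carrier (cocycle_ring R X)"
    using cs by (induction cs) (auto simp: ring_product_def)
  have "map (cohomology_class R X) cs = zs"
    using a(2) by (auto simp: cs_def intro: nth_equalityI)
  then have "ring_product (cohomology_ring R X) zs = cohomology_class R X ?c"
    using ring_product_hom[OF cohomology_class_ring_hom_ring cs] by simp
  moreover have "vanishes_on X ?c (W i)" if "i \<le> n" for i
    using vanishes_on_ring_product[of "a i" cs X "W i" R] a(3)[of i] zs(2) that by (auto simp: cs_def)
  then have "?c \<in> coboundaries R X"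
    using cocycle_vanishing_on_small_simplices[of "W ` {..n}" X ?c R] W c
    by (auto simp: vanishes_on_def)
  ultimately show ?thesis
    using cohomology_class_eq_zero_iff[OF c] by simp
qed


section \<open>Homotopy orbit spaces\<close>

text \<open>
For invariant \<open>U\<close> this is the homotopy orbit space of \<open>U\<close>, realised inside that of \<open>X\<close>.  For open
\<open>U\<close> its subspace topology is the quotient topology of \<open>EG \<times> U\<close>.
\<close>

definition homotopy_orbit_subset ::
    "('g, 'm) monoid_scheme \<Rightarrow> 'e topology \<Rightarrow> ('g \<Rightarrow> 'e \<Rightarrow> 'e) \<Rightarrow>
     'x topology \<Rightarrow> ('g \<Rightarrow> 'x \<Rightarrow> 'x) \<Rightarrow> 'x set \<Rightarrow> ('e \<times> 'x) set set" where
  "homotopy_orbit_subset G E \<epsilon> X \<alpha> U = orbit G (diag_action E \<epsilon> X \<alpha>) ` (topspace E \<times> U)"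

lemma orbit_diag_action:
  assumes "e \<in> topspace E" "x \<in> topspace X"
  shows "orbit G (diag_action E \<epsilon> X \<alpha>) (e, x) = (\<lambda>\<gamma>. (\<epsilon> \<gamma> e, \<alpha> \<gamma> x)) ` carrier G"
  using assms by (auto simp: orbit_def diag_action_def)

lemma homotopy_orbit_map_orbit:
  assumes "e \<in> topspace E" "x \<in> topspace X" "f x \<in> topspace Y"
    and "\<And>\<gamma>. \<gamma> \<in> carrier G \<Longrightarrow> f (\<alpha> \<gamma> x) = \<beta> \<gamma> (f x)"
  shows "homotopy_orbit_map f (orbit G (diag_action E \<epsilon> X \<alpha>) (e, x)) =
    orbit G (diag_action E \<epsilon> Y \<beta>) (e, f x)"
proof -
  have "map_prod id f ` (\<lambda>\<gamma>. (\<epsilon> \<gamma> e, \<alpha> \<gamma> x)) ` carrier G = (\<lambda>\<gamma>. (\<epsilon> \<gamma> e, \<beta> \<gamma> (f x))) ` carrier G"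
    unfolding image_image by (rule image_cong) (use assms in auto)
  then show ?thesis
    unfolding homotopy_orbit_map_def orbit_diag_action[OF assms(1,2)] orbit_diag_action[OF assms(1,3)] .
qed

lemma homotopy_orbit_map_compose:
  "homotopy_orbit_map (g \<circ> f) = homotopy_orbit_map g \<circ> homotopy_orbit_map f"
  by (simp add: homotopy_orbit_map_def fun_eq_iff image_image prod.map_comp)

lemma quotient_map_homotopy_orbit_space:
  "quotient_map (prod_topology E X) (homotopy_orbit_space G E \<epsilon> X \<alpha>) (orbit G (diag_action E \<epsilon> X \<alpha>))"
  unfolding homotopy_orbit_space_def by (rule quotient_map_orbit_space)

lemma topspace_homotopy_orbit_space:
  "topspace (homotopy_orbit_space G E \<epsilon> X \<alpha>) = homotopy_orbit_subset G E \<epsilon> X \<alpha> (topspace X)"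
  using quotient_imp_surjective_map[OF quotient_map_homotopy_orbit_space[of E X G \<epsilon> \<alpha>]]
  by (simp add: homotopy_orbit_subset_def)

lemma homotopy_orbit_subset_saturated:
  assumes E: "G_space G T E \<epsilon>" and X: "G_space G T X \<alpha>"
    and U: "U \<subseteq> topspace X" "\<And>\<gamma> x. \<gamma> \<in> carrier G \<Longrightarrow> x \<in> U \<Longrightarrow> \<alpha> \<gamma> x \<in> U"
  shows "{p \<in> topspace (prod_topology E X).
      orbit G (diag_action E \<epsilon> X \<alpha>) p \<in> homotopy_orbit_subset G E \<epsilon> X \<alpha> U} = topspace E \<times> U"
proof -
  interpret E: group_action G "topspace E" \<epsilon> using E by (simp add: G_space_def)
  interpret X: group_action G "topspace X" \<alpha> using X by (simp add: G_space_def)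
  interpret group G using E.group_hom by (rule group_hom.axioms(1))
  have self: "(e, x) \<in> orbit G (diag_action E \<epsilon> X \<alpha>) (e, x)" if "e \<in> topspace E" "x \<in> topspace X" for e x
    using that E.id_eq_one X.id_eq_one
    by (auto simp: orbit_diag_action intro!: image_eqI[of _ _ "\<one>\<^bsub>G\<^esub>"]) (metis restrict_apply')+
  have "x \<in> U" if "e \<in> topspace E" "x \<in> topspace X" "e' \<in> topspace E" "x' \<in> U"
    "orbit G (diag_action E \<epsilon> X \<alpha>) (e, x) = orbit G (diag_action E \<epsilon> X \<alpha>) (e', x')" for e x e' x'
  proof -
    have "(e, x) \<in> orbit G (diag_action E \<epsilon> X \<alpha>) (e', x')"
      using self[OF that(1,2)] that(5) by simp
    then show ?thesis
      using that U by (auto simp: orbit_diag_action subset_iff)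
  qed
  then show ?thesis
    using U(1) by (auto simp: homotopy_orbit_subset_def)
qed

lemma openin_homotopy_orbit_subset:
  assumes "G_space G T E \<epsilon>" "G_space G T X \<alpha>"
    and "openin X U" "\<And>\<gamma> x. \<gamma> \<in> carrier G \<Longrightarrow> x \<in> U \<Longrightarrow> \<alpha> \<gamma> x \<in> U"
  shows "openin (homotopy_orbit_space G E \<epsilon> X \<alpha>) (homotopy_orbit_subset G E \<epsilon> X \<alpha> U)"
proof -
  have "U \<subseteq> topspace X"
    using assms(3) by (rule openin_subset)
  moreover from this have "homotopy_orbit_subset G E \<epsilon> X \<alpha> U \<subseteq> topspace (homotopy_orbit_space G E \<epsilon> X \<alpha>)"
    unfolding topspace_homotopy_orbit_space by (auto simp: homotopy_orbit_subset_def)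
  moreover have "openin (homotopy_orbit_space G E \<epsilon> X \<alpha>) V \<longleftrightarrow>
      openin (prod_topology E X) {p \<in> topspace (prod_topology E X). orbit G (diag_action E \<epsilon> X \<alpha>) p \<in> V}"
    if "V \<subseteq> topspace (homotopy_orbit_space G E \<epsilon> X \<alpha>)" for V
    using quotient_map_homotopy_orbit_space[of E X G \<epsilon> \<alpha>] that unfolding quotient_map_def by blast
  ultimately show ?thesis
    using homotopy_orbit_subset_saturated[OF assms(1,2) _ assms(4)] assms(3)
    by (simp only: openin_prod_Times_iff openin_topspace simp_thms)
qed

text \<open>
An equivariant homotopy \<open>h\<close> yields \<open>(t, [e, x]) \<mapsto> [e, h(t, x)]\<close>.  It is continuous because the orbit map of
\<open>EG \<times> U\<close> remains a quotient map after restriction to a saturated open set and after multiplication by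
the locally compact interval.
\<close>

lemma homotopic_homotopy_orbit_map:
  fixes E :: "'e topology" and X :: "'x topology"
  assumes E: "G_space G T E \<epsilon>" and X: "G_space G T X \<alpha>"
    and U: "openin X U" "\<And>\<gamma> x. \<gamma> \<in> carrier G \<Longrightarrow> x \<in> U \<Longrightarrow> \<alpha> \<gamma> x \<in> U"
    and hom: "G_homotopic_on G X \<alpha> Y \<beta> U f g"
  shows "homotopic_with (\<lambda>h. True)
    (subtopology (homotopy_orbit_space G E \<epsilon> X \<alpha>) (homotopy_orbit_subset G E \<epsilon> X \<alpha> U))
    (homotopy_orbit_space G E \<epsilon> Y \<beta>) (homotopy_orbit_map f) (homotopy_orbit_map g)"
proof -
  let ?XU = "subtopology X U" and ?EU = "topspace E \<times> U"
  let ?Q = "subtopology (homotopy_orbit_space G E \<epsilon> X \<alpha>) (homotopy_orbit_subset G E \<epsilon> X \<alpha> U)"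
  let ?q = "orbit G (diag_action E \<epsilon> X \<alpha>)" and ?r = "orbit G (diag_action E \<epsilon> Y \<beta>)"
  let ?I = "top_of_set {0..1 :: real}"
  have UX: "U \<subseteq> topspace X"
    using U(1) by (rule openin_subset)
  obtain h where h: "continuous_map (cylinder ?XU) Y h" "\<And>x. h (0, x) = f x" "\<And>x. h (1, x) = g x"
    and equiv: "\<And>t \<gamma> x. t \<in> {0..1} \<Longrightarrow> \<gamma> \<in> carrier G \<Longrightarrow> x \<in> U \<Longrightarrow> h (t, \<alpha> \<gamma> x) = \<beta> \<gamma> (h (t, x))"
    using hom unfolding G_homotopic_on_def homotopic_with_def by blast
  define H where "H = (\<lambda>(t, C :: ('e \<times> 'x) set). homotopy_orbit_map (\<lambda>x. h (t, x)) C)"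
  have "quotient_map (subtopology (prod_topology E X) ?EU) ?Q ?q"
    using quotient_map_restriction[OF quotient_map_homotopy_orbit_space
        homotopy_orbit_subset_saturated[OF E X UX U(2)]] openin_homotopy_orbit_subset[OF E X U] by simp
  moreover have "subtopology (prod_topology E X) ?EU = prod_topology E ?XU"
    by (simp add: subtopology_Times)
  ultimately have q: "quotient_map (prod_topology ?I (prod_topology E ?XU)) (prod_topology ?I ?Q)
      (\<lambda>(t, p). (t, ?q p))"
    by (intro quotient_map_prod_right) (auto intro!: compact_imp_locally_compact_space
        simp: compact_space_subtopology Hausdorff_space_subtopology)
  have "continuous_map (prod_topology ?I (prod_topology E ?XU)) (homotopy_orbit_space G E \<epsilon> Y \<beta>)
      (?r \<circ> (\<lambda>y. (fst (snd y), h (fst y, snd (snd y)))))"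
  proof (rule continuous_map_compose)
    have "continuous_map (prod_topology ?I (prod_topology E ?XU)) (cylinder ?XU) (\<lambda>y. (fst y, snd (snd y)))"
      by (intro continuous_map_pairedI continuous_map_fst
          continuous_map_compose[OF continuous_map_snd continuous_map_snd, unfolded comp_def])
    then have "continuous_map (prod_topology ?I (prod_topology E ?XU)) Y (\<lambda>y. h (fst y, snd (snd y)))"
      using continuous_map_compose[OF _ h(1)] by (simp add: comp_def)
    then show "continuous_map (prod_topology ?I (prod_topology E ?XU)) (prod_topology E Y)
        (\<lambda>y. (fst (snd y), h (fst y, snd (snd y))))"
      by (intro continuous_map_pairedI
          continuous_map_compose[OF continuous_map_snd continuous_map_fst, unfolded comp_def])
    show "continuous_map (prod_topology E Y) (homotopy_orbit_space G E \<epsilon> Y \<beta>) ?r"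
      by (rule quotient_imp_continuous_map[OF quotient_map_homotopy_orbit_space])
  qed
  moreover have "(?r \<circ> (\<lambda>y. (fst (snd y), h (fst y, snd (snd y))))) y = (H \<circ> (\<lambda>(t, p). (t, ?q p))) y"
    if y_in: "y \<in> topspace (prod_topology ?I (prod_topology E ?XU))" for y
  proof -
    obtain t e x where y: "y = (t, e, x)" "t \<in> {0..1}" "e \<in> topspace E" "x \<in> U" "x \<in> topspace X"
      using y_in by (cases y) auto
    have "h (t, x) \<in> topspace Y"
      using h(1) y by (auto simp: continuous_map_def)
    then show ?thesis
      using y homotopy_orbit_map_orbit[of e E x X "\<lambda>x. h (t, x)" Y G \<alpha> \<beta> \<epsilon>] equiv
      by (simp add: H_def)
  qed
  ultimately have "continuous_map (prod_topology ?I (prod_topology E ?XU)) (homotopy_orbit_space G E \<epsilon> Y \<beta>)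
      (H \<circ> (\<lambda>(t, p). (t, ?q p)))"
    by (rule continuous_map_eq)
  then have "continuous_map (cylinder ?Q) (homotopy_orbit_space G E \<epsilon> Y \<beta>) H"
    by (rule continuous_compose_quotient_map[OF q])
  moreover have "H (0, C) = homotopy_orbit_map f C" "H (1, C) = homotopy_orbit_map g C" for C
    by (simp_all add: H_def h)
  ultimately show ?thesis
    unfolding homotopic_with_def by auto
qed

text \<open>
Continuity is the special case of the constant homotopy on all of \<open>X\<close>.
\<close>

lemma continuous_map_homotopy_orbit_map:
  assumes E: "G_space G T E \<epsilon>" and X: "G_space G T X \<alpha>" and f: "G_map G X \<alpha> Y \<beta> f"
  shows "continuous_map (homotopy_orbit_space G E \<epsilon> X \<alpha>) (homotopy_orbit_space G E \<epsilon> Y \<beta>)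
    (homotopy_orbit_map f)"
proof -
  interpret X: group_action G "topspace X" \<alpha> using X by (simp add: G_space_def)
  have "G_homotopic_on G X \<alpha> Y \<beta> (topspace X) f f"
    using f by (simp add: G_homotopic_on_def G_map_def)
  then have "homotopic_with (\<lambda>h. True)
    (subtopology (homotopy_orbit_space G E \<epsilon> X \<alpha>) (homotopy_orbit_subset G E \<epsilon> X \<alpha> (topspace X)))
    (homotopy_orbit_space G E \<epsilon> Y \<beta>) (homotopy_orbit_map f) (homotopy_orbit_map f)"
    using X.element_image by (intro homotopic_homotopy_orbit_map[OF E X]) auto
  then show ?thesis
    by (simp flip: topspace_homotopy_orbit_space)
qed

text \<open>
Keep the first component fixed and move the second one along the homotopy.
\<close>

lemma G_homotopic_on_graph:
  assumes f: "G_map G X \<alpha> Y \<beta> f" and hom: "G_homotopic_on G X \<alpha> Y \<beta> U f g" and U: "U \<subseteq> topspace X"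
  shows "G_homotopic_on G X \<alpha> (prod_topology Y Y) (diag_action Y \<beta> Y \<beta>) U (\<lambda>x. (f x, f x)) (\<lambda>x. (f x, g x))"
proof -
  let ?XU = "subtopology X U"
  obtain h where h: "continuous_map (cylinder ?XU) Y h" "\<And>x. h (0, x) = f x" "\<And>x. h (1, x) = g x"
    and equiv: "\<And>t \<gamma> x. t \<in> {0..1} \<Longrightarrow> \<gamma> \<in> carrier G \<Longrightarrow> x \<in> U \<Longrightarrow> h (t, \<alpha> \<gamma> x) = \<beta> \<gamma> (h (t, x))"
    using hom unfolding G_homotopic_on_def homotopic_with_def by blast
  have f': "continuous_map X Y f"
    using f by (simp add: G_map_def)
  let ?k = "\<lambda>y. (f (snd y), h y)"
  have "continuous_map ?XU Y f"
    using f' by (rule continuous_map_from_subtopology)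
  then have "continuous_map (cylinder ?XU) (prod_topology Y Y) ?k"
    using h(1) by (intro continuous_map_pairedI continuous_map_compose[OF continuous_map_snd, unfolded comp_def])
  moreover have "?k (t, \<alpha> \<gamma> x) = diag_action Y \<beta> Y \<beta> \<gamma> (?k (t, x))"
    if "t \<in> {0..1}" "\<gamma> \<in> carrier G" "x \<in> U" for t \<gamma> x
  proof -
    have x: "x \<in> topspace X" using U that by auto
    then have "f x \<in> topspace Y" "h (t, x) \<in> topspace Y"
      using f' h(1) that by (auto simp: continuous_map_def)
    moreover have "f (\<alpha> \<gamma> x) = \<beta> \<gamma> (f x)"
      using f x that by (simp add: G_map_def)
    ultimately show ?thesis
      using equiv[OF that] by (simp add: diag_action_def)
  qed
  ultimately show ?thesis
    unfolding G_homotopic_on_def homotopic_with_def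
    by (intro exI[of _ ?k]) (simp add: h)
qed

lemma G_map_pair:
  assumes "G_map G X \<alpha> Y \<beta> f" "G_map G X \<alpha> Z \<zeta> g"
  shows "G_map G X \<alpha> (prod_topology Y Z) (diag_action Y \<beta> Z \<zeta>) (\<lambda>x. (f x, g x))"
  using assms unfolding G_map_def
  by (auto simp: diag_action_def continuous_map_def[of X Y] continuous_map_def[of X Z] Pi_iff
      intro!: continuous_map_pairedI)


section \<open>Cohomological lower bounds for the equivariant homotopic distance\<close>

lemma le_equivariant_homotopic_distance:
  assumes "\<And>n U. (\<And>i. i \<le> n \<Longrightarrow> openin X (U i)) \<Longrightarrow>
      (\<And>i \<gamma> x. i \<le> n \<Longrightarrow> \<gamma> \<in> carrier G \<Longrightarrow> x \<in> U i \<Longrightarrow> \<alpha> \<gamma> x \<in> U i) \<Longrightarrow>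
      (\<And>i. i \<le> n \<Longrightarrow> G_homotopic_on G X \<alpha> Y \<beta> (U i) f g) \<Longrightarrow>
      (\<Union>i\<le>n. U i) = topspace X \<Longrightarrow> k \<le> n"
  shows "enat k \<le> equivariant_homotopic_distance G X \<alpha> Y \<beta> f g"
  unfolding equivariant_homotopic_distance_def
proof (rule Inf_greatest, clarsimp)
  fix n :: nat and U
  assume "\<forall>i\<le>n. openin X (U i) \<and> (\<forall>\<gamma>\<in>carrier G. \<forall>x\<in>U i. \<alpha> \<gamma> x \<in> U i) \<and> G_homotopic_on G X \<alpha> Y \<beta> (U i) f g"
    and "(\<Union>i\<le>n. U i) = topspace X"
  then show "k \<le> n"
    by (intro assms[of n U]) auto
qed

text \<open>
The common core of both bounds: the classes are required to vanish on the piece over every invariant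
open set on which \<open>f\<close> and \<open>g\<close> are \<open>G\<close>-homotopic, in particular on all members of an admissible cover.
\<close>

lemma borel_product_nonzero_bound:
  fixes R :: "'r::{comm_ring, comm_monoid_mult} itself"
  assumes E: "G_space G T E \<epsilon>" and X: "G_space G T X \<alpha>"
    and zs: "set zs \<subseteq> carrier (borel_cohomology R G E \<epsilon> X \<alpha>)"
    and nonzero: "ring_product (borel_cohomology R G E \<epsilon> X \<alpha>) zs \<noteq> \<zero>\<^bsub>borel_cohomology R G E \<epsilon> X \<alpha>\<^esub>"
    and zero: "\<And>z U. z \<in> set zs \<Longrightarrow> openin X U \<Longrightarrow> (\<And>\<gamma> x. \<gamma> \<in> carrier G \<Longrightarrow> x \<in> U \<Longrightarrow> \<alpha> \<gamma> x \<in> U) \<Longrightarrow>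
      G_homotopic_on G X \<alpha> Y \<beta> U f g \<Longrightarrow>
      cohomology_map R (subtopology (homotopy_orbit_space G E \<epsilon> X \<alpha>) (homotopy_orbit_subset G E \<epsilon> X \<alpha> U)) id z =
      \<zero>\<^bsub>cohomology_ring R (subtopology (homotopy_orbit_space G E \<epsilon> X \<alpha>) (homotopy_orbit_subset G E \<epsilon> X \<alpha> U))\<^esub>"
  shows "enat (length zs) \<le> equivariant_homotopic_distance G X \<alpha> Y \<beta> f g"
proof (rule le_equivariant_homotopic_distance, rule ccontr)
  fix n U
  assume U: "\<And>i. i \<le> n \<Longrightarrow> openin X (U i)" "\<And>i \<gamma> x. i \<le> n \<Longrightarrow> \<gamma> \<in> carrier G \<Longrightarrow> x \<in> U i \<Longrightarrow> \<alpha> \<gamma> x \<in> U i"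
      "\<And>i. i \<le> n \<Longrightarrow> G_homotopic_on G X \<alpha> Y \<beta> (U i) f g" "(\<Union>i\<le>n. U i) = topspace X"
    and "\<not> length zs \<le> n"
  then have n: "n < length zs" by simp
  let ?XH = "homotopy_orbit_space G E \<epsilon> X \<alpha>" and ?W = "\<lambda>i. homotopy_orbit_subset G E \<epsilon> X \<alpha> (U i)"
  have "topspace ?XH \<subseteq> (\<Union>i\<le>n. ?W i)"
    unfolding topspace_homotopy_orbit_space U(4)[symmetric] by (auto simp: homotopy_orbit_subset_def)
  moreover have "openin ?XH (?W i)" if "i \<le> n" for i
    using openin_homotopy_orbit_subset[OF E X U(1)[OF that] U(2)[OF that]] .
  moreover have "cohomology_map R (subtopology ?XH (?W i)) id z = \<zero>\<^bsub>cohomology_ring R (subtopology ?XH (?W i))\<^esub>"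
    if "z \<in> set zs" "i \<le> n" for z i
    using zero[OF that(1) U(1)[OF that(2)] U(2)[OF that(2)] U(3)[OF that(2)]] .
  ultimately have "ring_product (cohomology_ring R ?XH) zs = \<zero>\<^bsub>cohomology_ring R ?XH\<^esub>"
    using zs n by (intro ring_product_zero_if_locally_zero[where W = ?W]) (auto simp: borel_cohomology_def)
  then show False
    using nonzero by (simp add: borel_cohomology_def)
qed

theorem theorem3p8:
  fixes R :: "'r::{comm_ring, comm_monoid_mult} itself"
    and G :: "('g, 'm) monoid_scheme" and T :: "'g topology"
    and EG :: "'e topology" and \<epsilon> :: "'g \<Rightarrow> 'e \<Rightarrow> 'e"
    and X :: "'x topology" and \<alpha> :: "'g \<Rightarrow> 'x \<Rightarrow> 'x"
    and Y :: "'y topology" and \<beta> :: "'g \<Rightarrow> 'y \<Rightarrow> 'y"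
    and f g :: "'x \<Rightarrow> 'y"
  assumes "compact_lie_group G T"
    and "universal_principal_bundle G T EG \<epsilon>"
    and "G_space G T X \<alpha>"
    and "G_space G T Y \<beta>"
    and "G_map G X \<alpha> Y \<beta> f"
    and "G_map G X \<alpha> Y \<beta> g"
  shows "(\<forall>zs.
            set zs \<subseteq> carrier (borel_cohomology R G EG \<epsilon> (prod_topology Y Y) (diag_action Y \<beta> Y \<beta>)) \<and>
            (\<forall>z\<in>set zs. borel_map R G EG \<epsilon> Y \<beta> (\<lambda>y. (y, y)) z = \<zero>\<^bsub>borel_cohomology R G EG \<epsilon> Y \<beta>\<^esub>) \<and>
            borel_map R G EG \<epsilon> X \<alpha> (\<lambda>x. (f x, g x))
              (ring_product (borel_cohomology R G EG \<epsilon> (prod_topology Y Y) (diag_action Y \<beta> Y \<beta>)) zs)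
              \<noteq> \<zero>\<^bsub>borel_cohomology R G EG \<epsilon> X \<alpha>\<^esub>
            \<longrightarrow> equivariant_homotopic_distance G X \<alpha> Y \<beta> f g \<ge> enat (length zs)) \<and>
         equivariant_homotopic_distance G X \<alpha> Y \<beta> f g
           \<ge> nil (borel_cohomology R G EG \<epsilon> X \<alpha>) (borel_difference_image R G EG \<epsilon> X \<alpha> Y \<beta> f g)"
proof -
  let ?YY = "prod_topology Y Y" and ?\<delta> = "diag_action Y \<beta> Y \<beta>"
  let ?h = "\<lambda>x. (f x, g x)" and ?\<Delta> = "\<lambda>y :: 'y. (y, y)"
  let ?EX = "homotopy_orbit_space G EG \<epsilon> X \<alpha>" and ?EY = "homotopy_orbit_space G EG \<epsilon> Y \<beta>"
  let ?EYY = "homotopy_orbit_space G EG \<epsilon> ?YY ?\<delta>"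
  let ?EU = "\<lambda>U. subtopology ?EX (homotopy_orbit_subset G EG \<epsilon> X \<alpha> U)"
  have E: "G_space G T EG \<epsilon>"
    using assms(2) by (simp add: universal_principal_bundle_def principal_bundle_def)
  note X = assms(3) and Y = assms(4) and f = assms(5) and g = assms(6)
  have "G_map G Y \<beta> Y \<beta> (\<lambda>y. y)"
    by (simp add: G_map_def)
  then have cont_\<Delta>: "continuous_map ?EY ?EYY (homotopy_orbit_map ?\<Delta>)"
    by (intro continuous_map_homotopy_orbit_map[OF E Y] G_map_pair)
  note cont_h = continuous_map_homotopy_orbit_map[OF E X G_map_pair[OF f g]]
  note cont_f = continuous_map_homotopy_orbit_map[OF E X f]
  note cont_g = continuous_map_homotopy_orbit_map[OF E X g]
  have cont_id: "continuous_map (?EU U) ?EX id" for U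
    by (simp add: continuous_map_from_subtopology)
  have restrict: "cohomology_map R (?EU U) id (cohomology_map R ?EX k z) = cohomology_map R (?EU U) k z"
    if "continuous_map ?EX S k" "z \<in> carrier (cohomology_ring R S)"
    for U and k and S :: "'s topology" and z
    using cohomology_map_compose[OF cont_id that] by simp
  have part1: "enat (length zs) \<le> equivariant_homotopic_distance G X \<alpha> Y \<beta> f g"
    if zs: "set zs \<subseteq> carrier (cohomology_ring R ?EYY)"
      and zero: "\<And>z. z \<in> set zs \<Longrightarrow> cohomology_map R ?EY (homotopy_orbit_map ?\<Delta>) z = \<zero>\<^bsub>cohomology_ring R ?EY\<^esub>"
      and nonzero: "cohomology_map R ?EX (homotopy_orbit_map ?h) (ring_product (cohomology_ring R ?EYY) zs)
        \<noteq> \<zero>\<^bsub>cohomology_ring R ?EX\<^esub>"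
    for zs
  proof -
    let ?ws = "map (cohomology_map R ?EX (homotopy_orbit_map ?h)) zs"
    have "enat (length ?ws) \<le> equivariant_homotopic_distance G X \<alpha> Y \<beta> f g"
    proof (rule borel_product_nonzero_bound[OF E X, of _ R])
      show "set ?ws \<subseteq> carrier (borel_cohomology R G EG \<epsilon> X \<alpha>)"
        using zs cohomology_map_closed[OF cont_h] by (auto simp: borel_cohomology_def)
      show "ring_product (borel_cohomology R G EG \<epsilon> X \<alpha>) ?ws \<noteq> \<zero>\<^bsub>borel_cohomology R G EG \<epsilon> X \<alpha>\<^esub>"
        using nonzero ring_product_hom[OF cohomology_map_ring_hom_ring[OF cont_h] zs]
        by (simp add: borel_cohomology_def)
    next
      fix w U
      assume "w \<in> set ?ws" and U: "openin X U" "\<And>\<gamma> x. \<gamma> \<in> carrier G \<Longrightarrow> x \<in> U \<Longrightarrow> \<alpha> \<gamma> x \<in> U"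
        and hom: "G_homotopic_on G X \<alpha> Y \<beta> U f g"
      then obtain z where z: "z \<in> set zs" "w = cohomology_map R ?EX (homotopy_orbit_map ?h) z"
        and zC: "z \<in> carrier (cohomology_ring R ?EYY)"
        using zs by auto
      have cont_fU: "continuous_map (?EU U) ?EY (homotopy_orbit_map f)"
        using cont_f by (rule continuous_map_from_subtopology)
      interpret fU: ring_hom_ring "cohomology_ring R ?EY" "cohomology_ring R (?EU U)"
        "cohomology_map R (?EU U) (homotopy_orbit_map f)"
        by (rule cohomology_map_ring_hom_ring[OF cont_fU])
      have "cohomology_map R (?EU U) id w = cohomology_map R (?EU U) (homotopy_orbit_map ?h) z"
        using restrict[OF cont_h zC] z(2) by simp
      also have "\<dots> = cohomology_map R (?EU U) (homotopy_orbit_map (\<lambda>x. (f x, f x))) z"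
        using cohomology_map_homotopic[OF homotopic_homotopy_orbit_map[OF E X U
              G_homotopic_on_graph[OF f hom openin_subset[OF U(1)]]] zC] by simp
      also have "(\<lambda>x. (f x, f x)) = ?\<Delta> \<circ> f"
        by auto
      also have "cohomology_map R (?EU U) (homotopy_orbit_map (?\<Delta> \<circ> f)) z =
          cohomology_map R (?EU U) (homotopy_orbit_map f) (cohomology_map R ?EY (homotopy_orbit_map ?\<Delta>) z)"
        using cohomology_map_compose[OF cont_fU cont_\<Delta> zC] by (simp add: homotopy_orbit_map_compose)
      also have "\<dots> = \<zero>\<^bsub>cohomology_ring R (?EU U)\<^esub>"
        using zero[OF z(1)] by simp
      finally show "cohomology_map R (?EU U) id w = \<zero>\<^bsub>cohomology_ring R (?EU U)\<^esub>" .
    qed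
    then show ?thesis by simp
  qed
  have part2: "enat (length zs) \<le> equivariant_homotopic_distance G X \<alpha> Y \<beta> f g"
    if zs: "set zs \<subseteq> borel_difference_image R G EG \<epsilon> X \<alpha> Y \<beta> f g"
      and nonzero: "ring_product (borel_cohomology R G EG \<epsilon> X \<alpha>) zs \<noteq> \<zero>\<^bsub>borel_cohomology R G EG \<epsilon> X \<alpha>\<^esub>"
    for zs
  proof (rule borel_product_nonzero_bound[OF E X _ nonzero])
    interpret EX: ring "cohomology_ring R ?EX" by (rule ring_cohomology_ring)
    note closed = cohomology_map_closed[OF cont_f, where R = R] cohomology_map_closed[OF cont_g, where R = R]
    have zs': "\<exists>y\<in>carrier (cohomology_ring R ?EY). z = cohomology_map R ?EX (homotopy_orbit_map f) y
        \<ominus>\<^bsub>cohomology_ring R ?EX\<^esub> cohomology_map R ?EX (homotopy_orbit_map g) y" if "z \<in> set zs" for z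
      using zs that by (auto simp: borel_difference_image_def borel_map_def borel_cohomology_def)
    then show "set zs \<subseteq> carrier (borel_cohomology R G EG \<epsilon> X \<alpha>)"
      using closed by (fastforce simp: borel_cohomology_def)
    fix z U
    assume "z \<in> set zs" and U: "openin X U" "\<And>\<gamma> x. \<gamma> \<in> carrier G \<Longrightarrow> x \<in> U \<Longrightarrow> \<alpha> \<gamma> x \<in> U"
      and hom: "G_homotopic_on G X \<alpha> Y \<beta> U f g"
    then obtain y where y: "y \<in> carrier (cohomology_ring R ?EY)"
      and z: "z = cohomology_map R ?EX (homotopy_orbit_map f) y
        \<ominus>\<^bsub>cohomology_ring R ?EX\<^esub> cohomology_map R ?EX (homotopy_orbit_map g) y"
      using zs' by blast
    interpret U: ring_hom_ring "cohomology_ring R ?EX" "cohomology_ring R (?EU U)" "cohomology_map R (?EU U) id"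
      by (rule cohomology_map_ring_hom_ring[OF cont_id])
    have "cohomology_map R (?EU U) id z = cohomology_map R (?EU U) (homotopy_orbit_map f) y
        \<ominus>\<^bsub>cohomology_ring R (?EU U)\<^esub> cohomology_map R (?EU U) (homotopy_orbit_map g) y"
      using closed[OF y] restrict[OF cont_f y] restrict[OF cont_g y]
      by (simp add: z a_minus_def)
    also have "cohomology_map R (?EU U) (homotopy_orbit_map f) y = cohomology_map R (?EU U) (homotopy_orbit_map g) y"
      by (rule cohomology_map_homotopic[OF homotopic_homotopy_orbit_map[OF E X U hom] y])
    also have "cohomology_map R (?EU U) (homotopy_orbit_map g) y \<ominus>\<^bsub>cohomology_ring R (?EU U)\<^esub>
        cohomology_map R (?EU U) (homotopy_orbit_map g) y = \<zero>\<^bsub>cohomology_ring R (?EU U)\<^esub>"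
      using cohomology_map_closed[OF continuous_map_from_subtopology[OF cont_g] y] U.S.r_neg
      by (simp add: a_minus_def)
    finally show "cohomology_map R (?EU U) id z = \<zero>\<^bsub>cohomology_ring R (?EU U)\<^esub>" .
  qed
  show ?thesis
    using part1 part2 by (auto simp: nil_def borel_cohomology_def borel_map_def intro!: Sup_least)
qed

end
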